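(* Let $M$ be a finite dimensional module over a finite dimensional group algebra $\mathbb{C}[G]$, where $G$ is a group of order $p_1^{k_1}\cdots p_m^{k_m}$ ($p_1,\dots,p_m$ distinct primes) with Sylow $p_i$-subgroups $S_i$, $i=1,\dots,m$. Let $M_1,\dots,M_m$ be the Savitskii Restrictions of $M$ to $\mathbb{C}[S_1],\dots,\mathbb{C}[S_m]$, and let $N$ be the Savitskii Induced Inverse of $M$. Then $$ M\otimes N \cong \mathcal{K}(M)\,\mathbb{C}[G] \qquad\text{and}\qquad \mathcal{K}(M)=\prod_{i=1}^m \mathcal{K}(M_i). $$
   Context: For a finite group $K$, a virtual $\mathbb{C}[K]$-module is an integer linear combination of simple $\mathbb{C}[K]$-modules, i.e. an element of the representation ring (direct sum as addition, tensor product as multiplication); equivalently, one may work with virtual characters. Isomorphism of virtual modules means equality in this ring, $\mathbb{C}[K]$ also denotes the regular module, and dimension and induction extend additively to virtual modules. Knutson Index: for a (possibly virtual) $\mathbb{C}[K]$-module $X$, $\mathcal{K}(X)$ is the smallest strictly positive integer $n$ such that $X\otimes Y\cong n\,\mathbb{C}[K]$ for some virtual $\mathbb{C}[K]$-module $Y$; such a $Y$ is called an $n$-regular inverse of $X$. If no such $n$ exists, the Knutson Index is infinite. Savitskii Restriction: let $r=\dim M$ and, for each $i$, let $p_i^{l_i}$ be the greatest common divisor of $r$ and $p_i^{k_i}$. By Bezout's identity there are integers $u_i,v_i$ with $u_i r+v_i p_i^{k_i}=p_i^{l_i}$; $u_i$ is always chosen minimal positive. The Savitskii Restriction of $M$ to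 $\mathbb{C}[S_i]$ is $M_i=u_i\,M|_{S_i}+v_i\,V_{S_i}$, where $M|_{S_i}$ is the usual restriction of $M$ to $\mathbb{C}[S_i]$ and $V_{S_i}$ is the regular module of $\mathbb{C}[S_i]$. Savitskii Induced Inverse: for each $i$ let $N_i$ be a $\mathcal{K}(M_i)$-regular inverse of $M_i$ and let $N_i^*$ be the module of $\mathbb{C}[G]$ induced from $N_i$. Then $\gcd(\dim N_1^*,\dots,\dim N_m^* )=p_1^{e_1}\cdots p_m^{e_m}$ with $e_i\le k_i$. The Savitskii Induced Inverse of $M$ is $N=a_1N_1^*+\dots+a_mN_m^*$, where $a_1,\dots,a_m$ are integers such that $p_1^{e_1}\cdots p_m^{e_m}=a_1\dim(N_1^* )+\dots+a_m\dim(N_m^* )$.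
   Formalization: M is taken nonzero and m ≥ 1, and the product formula is stated only when dim M divides |G|: for |G|=2 and M three copies of the trivial module, K(M)=3 but K(M_1)=1; for M=0, K(M) is infinite; for m=0, N is undefined. *)

theory Defs
  imports
    "HOL-Algebra.Group"
    "HOL-Library.Extended_Nat"
    "HOL-Computational_Algebra.Primes"
    "Jordan_Normal_Form.VS_Connect"
begin

text \<open>An \<open>n\<close>-dimensional \<open>\<complex>[G]\<close>-module is a matrix representation of \<open>G\<close> on \<open>\<complex>\<^sup>n\<close>.\<close>

definition matrix_rep :: "('a, 'b) monoid_scheme \<Rightarrow> nat \<Rightarrow> ('a \<Rightarrow> complex mat) \<Rightarrow> bool" where
  "matrix_rep G n \<rho> \<longleftrightarrow>
     (\<forall>g\<in>carrier G. \<rho> g \<in> carrier_mat n n) \<and>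
     \<rho> \<one>\<^bsub>G\<^esub> = 1\<^sub>m n \<and>
     (\<forall>g\<in>carrier G. \<forall>h\<in>carrier G. \<rho> (g \<otimes>\<^bsub>G\<^esub> h) = \<rho> g * \<rho> h)"

definition simple_rep :: "('a, 'b) monoid_scheme \<Rightarrow> nat \<Rightarrow> ('a \<Rightarrow> complex mat) \<Rightarrow> bool" where
  "simple_rep G n \<rho> \<longleftrightarrow>
     matrix_rep G n \<rho> \<and> 0 < n \<and>
     (\<forall>W. VectorSpace.subspace class_ring W (module_vec TYPE(complex) n) \<and>
          (\<forall>g\<in>carrier G. \<forall>w\<in>W. \<rho> g *\<^sub>v w \<in> W)
          \<longrightarrow> W = {0\<^sub>v n} \<or> W = carrier_vec n)"

text \<open>
  Virtual modules are represented by their virtual characters.  All characters are set to \<open>0\<close>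
  outside the carrier of the group, so that equality in the representation ring is equality of
  functions; sum and tensor product are the pointwise sum and product.
\<close>

definition character :: "('a, 'b) monoid_scheme \<Rightarrow> ('a \<Rightarrow> complex mat) \<Rightarrow> 'a \<Rightarrow> complex" where
  "character G \<rho> = (\<lambda>g. if g \<in> carrier G then (\<Sum>i<dim_row (\<rho> g). \<rho> g $$ (i, i)) else 0)"

definition virtual_char :: "('a, 'b) monoid_scheme \<Rightarrow> ('a \<Rightarrow> complex) \<Rightarrow> bool" where
  "virtual_char G X \<longleftrightarrow>
     (\<exists>R (c :: ('a \<Rightarrow> complex mat) \<Rightarrow> int).
        finite R \<and> (\<forall>\<rho>\<in>R. \<exists>n. simple_rep G n \<rho>) \<and>
        X = (\<lambda>g. \<Sum>\<rho>\<in>R. of_int (c \<rho>) * character G \<rho> g))"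

definition vdim :: "('a, 'b) monoid_scheme \<Rightarrow> ('a \<Rightarrow> complex) \<Rightarrow> int" where
  "vdim G X = (THE d. X \<one>\<^bsub>G\<^esub> = of_int d)"

text \<open>
  In the regular module \<open>g\<close> permutes the basis \<open>carrier G\<close> by left multiplication, so its trace
  is the number of fixed basis elements.
\<close>

definition regular_char :: "('a, 'b) monoid_scheme \<Rightarrow> 'a \<Rightarrow> complex" where
  "regular_char G =
     (\<lambda>g. if g \<in> carrier G then of_nat (card {x \<in> carrier G. g \<otimes>\<^bsub>G\<^esub> x = x}) else 0)"

definition restrict_char :: "'a set \<Rightarrow> ('a \<Rightarrow> complex) \<Rightarrow> 'a \<Rightarrow> complex" where
  "restrict_char H X = (\<lambda>h. if h \<in> H then X h else 0)"

text \<open>Character of the induced module, by Frobenius' formula.\<close>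

definition induced_char ::
  "('a, 'b) monoid_scheme \<Rightarrow> 'a set \<Rightarrow> ('a \<Rightarrow> complex) \<Rightarrow> 'a \<Rightarrow> complex" where
  "induced_char G H X =
     (\<lambda>g. if g \<in> carrier G
          then (\<Sum>x | x \<in> carrier G \<and> inv\<^bsub>G\<^esub> x \<otimes>\<^bsub>G\<^esub> g \<otimes>\<^bsub>G\<^esub> x \<in> H.
                  X (inv\<^bsub>G\<^esub> x \<otimes>\<^bsub>G\<^esub> g \<otimes>\<^bsub>G\<^esub> x)) / of_nat (card H)
          else 0)"

definition regular_inverse ::
  "('a, 'b) monoid_scheme \<Rightarrow> ('a \<Rightarrow> complex) \<Rightarrow> nat \<Rightarrow> ('a \<Rightarrow> complex) \<Rightarrow> bool" where
  "regular_inverse G X n Y \<longleftrightarrow>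
     virtual_char G Y \<and> (\<lambda>g. X g * Y g) = (\<lambda>g. of_nat n * regular_char G g)"

text \<open>The infimum of the empty set of extended naturals is \<open>\<infinity>\<close>.\<close>

definition knutson_index :: "('a, 'b) monoid_scheme \<Rightarrow> ('a \<Rightarrow> complex) \<Rightarrow> enat" where
  "knutson_index G X = Inf {enat n | n. 0 < n \<and> (\<exists>Y. regular_inverse G X n Y)}"

definition savitskii_u :: "int \<Rightarrow> int \<Rightarrow> nat" where
  "savitskii_u r q = (LEAST u. 0 < u \<and> (\<exists>v. int u * r + v * q = gcd r q))"

definition savitskii_v :: "int \<Rightarrow> int \<Rightarrow> int" where
  "savitskii_v r q = (THE v. int (savitskii_u r q) * r + v * q = gcd r q)"

text \<open>
  Below, \<open>X\<close> is the character of \<open>M\<close> and \<open>H\<close> a Sylow subgroup, so that \<open>card H\<close> is the prime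
  power \<open>p\<^sub>i ^ k\<^sub>i\<close>.
\<close>

definition savitskii_restriction ::
  "('a, 'b) monoid_scheme \<Rightarrow> 'a set \<Rightarrow> ('a \<Rightarrow> complex) \<Rightarrow> 'a \<Rightarrow> complex" where
  "savitskii_restriction G H X =
     (let r = vdim G X; q = int (card H)
      in (\<lambda>h. of_nat (savitskii_u r q) * restrict_char H X h
              + of_int (savitskii_v r q) * regular_char (G\<lparr>carrier := H\<rparr>) h))"

text \<open>
  The Savitskii Induced Inverse depends on the choice of the regular inverses \<open>Ns i\<close> and of the
  Bezout coefficients \<open>a i\<close>; the predicate holds for the results of all possible choices.
\<close>

definition savitskii_induced_inverse ::
  "('a, 'b) monoid_scheme \<Rightarrow> nat \<Rightarrow> (nat \<Rightarrow> 'a set) \<Rightarrow> ('a \<Rightarrow> complex) \<Rightarrow> ('a \<Rightarrow> complex) \<Rightarrow> bool" where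
  "savitskii_induced_inverse G m S X N \<longleftrightarrow>
     (\<exists>(Ns :: nat \<Rightarrow> 'a \<Rightarrow> complex) (a :: nat \<Rightarrow> int).
        (\<forall>i\<in>{1..m}. \<exists>n.
           knutson_index (G\<lparr>carrier := S i\<rparr>) (savitskii_restriction G (S i) X) = enat n \<and>
           regular_inverse (G\<lparr>carrier := S i\<rparr>) (savitskii_restriction G (S i) X) n (Ns i)) \<and>
        (\<Sum>i=1..m. a i * vdim G (induced_char G (S i) (Ns i)))
          = Gcd ((\<lambda>i. vdim G (induced_char G (S i) (Ns i))) ` {1..m}) \<and>
        N = (\<lambda>g. \<Sum>i=1..m. of_int (a i) * induced_char G (S i) (Ns i) g))"

end

theory Submission
  imports Defs "Jordan_Normal_Form.DL_Rank"
begin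

text \<open>
  Write \<open>r\<close> for the dimension of \<open>M\<close> and \<open>q\<^sub>i\<close> for the order of \<open>S\<^sub>i\<close>.  A virtual character \<open>Y\<close> is a
  regular inverse of \<open>M\<close> exactly when \<open>M Y\<close> is supported at the identity, is positive there, and
  has value at the identity divisible by \<open>|G|\<close>.  The index is then \<open>r Y(1) / |G|\<close>, so
  \<open>\<K>(M)\<close> is known once the least possible positive \<open>Y(1)\<close> is known.

  The Savitskii Restriction \<open>M\<^sub>i\<close> agrees with a positive multiple of \<open>M\<close> on \<open>S\<^sub>i\<close> away from the
  identity, so it has the same zeros there, while its dimension is the \<open>p\<^sub>i\<close>-power \<open>gcd r q\<^sub>i\<close>.
  This makes inverses travel in both directions.

  Upwards: if \<open>N\<^sub>i\<close> is a \<open>\<K>(M\<^sub>i)\<close>-regular inverse of \<open>M\<^sub>i\<close>, then \<open>M\<close> times the module induced from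
  \<open>N\<^sub>i\<close> is still supported at the identity, because \<open>M\<close> is a class function
  (\<open>induced_regular_inverse\<close>).  Hence \<open>N\<close>, a combination of induced modules, satisfies
  \<open>M N = n \<complex>[G]\<close> for some \<open>n\<close>.

  Downwards: if \<open>Y\<close> is a regular inverse of \<open>M\<close>, its restriction to \<open>S\<^sub>i\<close> is a regular inverse of
  \<open>M\<^sub>i\<close>.  All indices of regular inverses of \<open>M\<^sub>i\<close> are multiples of the least one
  (\<open>knutson_index_dvd\<close>), so \<open>D\<^sub>i = dim N\<^sub>i\<close> divides \<open>Y(1)\<close> (\<open>vdim_local_inverse_dvd\<close>).

  Each \<open>D\<^sub>i\<close> divides \<open>q\<^sub>i\<close>, so the \<open>D\<^sub>i\<close> are pairwise coprime and their product divides \<open>Y(1)\<close>.  The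
  induced modules have dimension \<open>D\<^sub>i |G| / q\<^sub>i\<close>, and the greatest common divisor of these numbers is
  exactly the product of the \<open>D\<^sub>i\<close> (\<open>Gcd_complementary_products\<close>).  The two bounds meet: \<open>N\<close> has
  the least positive dimension, and \<open>\<K>(M) |G| = r \<Prod> D\<^sub>i\<close>.  Since \<open>gcd r q\<^sub>i * D\<^sub>i = \<K>(M\<^sub>i) q\<^sub>i\<close>, this
  says that \<open>\<K>(M) * gcd r |G| = r \<Prod> \<K>(M\<^sub>i)\<close>, which is the product formula as soon as
  \<open>r\<close> divides \<open>|G|\<close>.

  What remains is that restriction and induction preserve virtual characters, a notion defined by
  simple modules.  Restricting or inducing a matrix representation gives a matrix representation, and
  every character is a sum of simple ones because a representation with an invariant subspace is
  block triangular in an adapted basis (\<open>virtual_char_character\<close>).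
\<close>

section \<open>Bases adapted to a subspace\<close>

context vec_space
begin

text \<open>
  An independent set of largest cardinality between \<open>U\<close> and \<open>W\<close> exists because
  cardinalities of independent sets are bounded by \<open>n\<close>, and it spans \<open>W\<close> since no vector of \<open>W\<close> can be added to it.
\<close>

lemma independent_set_extends_to_basis_of_subspace:
  assumes W: "VectorSpace.subspace class_ring W V"
    and UW: "U \<subseteq> W" and U: "lin_indpt U"
  obtains B where "U \<subseteq> B" "B \<subseteq> W" "finite B" "lin_indpt B" "span B = W"
proof -
  have Wc: "W \<subseteq> carrier_vec n" and subm: "LinearCombinations.submodule class_ring W V"
    using W by (auto simp: VectorSpace.subspace_def LinearCombinations.submodule_def)
  let ?P = "\<lambda>T. U \<subseteq> T \<and> T \<subseteq> W \<and> lin_indpt T"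
  have bound: "\<forall>T. ?P T \<longrightarrow> card T < Suc n"
    using Wc li_le_dim(2)[OF fin_dim] dim_is_n by (auto simp: less_Suc_eq_le)
  obtain B where B: "?P B" and max: "\<And>T. ?P T \<Longrightarrow> card T \<le> card B"
    using ex_has_greatest_nat[of ?P U card, OF _ bound] UW U by blast
  have Bc: "B \<subseteq> carrier_vec n" using B Wc by auto
  have fin: "finite B" using li_le_dim(1)[OF fin_dim Bc] B by simp
  have "w \<in> span B" if w: "w \<in> W" for w
  proof (rule ccontr)
    assume nw: "w \<notin> span B"
    have wB: "w \<notin> B" using nw Bc in_own_span by auto
    have "?P (insert w B)"
      using lin_dep_iff_in_span[OF Bc _ _ wB] nw w B Wc by auto
    from max[OF this] show False using fin wB by simp
  qed
  moreover have "span B \<subseteq> W" using span_is_subset[OF _ subm] B by blast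
  ultimately show ?thesis
    using B fin by (intro that[of B]) auto
qed

text \<open>
  The columns of \<open>P\<close> are a basis of the space whose first \<open>k\<close> members are a basis of \<open>W\<close>; the
  last conclusion says that coordinates with respect to this basis put \<open>W\<close> into the first \<open>k\<close>
  places.  Both bounds on \<open>k\<close> are strict, which lets an induction on the dimension split off \<open>W\<close>.
\<close>

lemma basis_adapted_to_subspace:
  assumes W: "VectorSpace.subspace class_ring W V"
    and W0: "W \<noteq> {0\<^sub>v n}" and Wn: "W \<noteq> carrier_vec n"
  obtains P Q :: "'a mat" and k where "P \<in> carrier_mat n n" "Q \<in> carrier_mat n n"
    "Q * P = 1\<^sub>m n" "P * Q = 1\<^sub>m n" "0 < k" "k < n"
    "\<And>j. j < k \<Longrightarrow> col P j \<in> W"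
    "\<And>w i. w \<in> W \<Longrightarrow> k \<le> i \<Longrightarrow> i < n \<Longrightarrow> (Q *\<^sub>v w) $ i = 0"
proof -
  have Wc: "W \<subseteq> carrier_vec n"
    using W by (auto simp: VectorSpace.subspace_def LinearCombinations.submodule_def)
  have "lin_indpt {}" by (rule finite_lin_indpt2) auto
  then obtain B where B: "B \<subseteq> W" "finite B" "lin_indpt B" "span B = W"
    using independent_set_extends_to_basis_of_subspace[OF W empty_subsetI] by metis
  have "VectorSpace.subspace class_ring (carrier_vec n) V"
    using span_unit_vecs_is_carrier span_is_subspace[of "set (unit_vecs n)"] unit_vecs_basis
    by (auto simp: basis_def)
  moreover have "B \<subseteq> carrier_vec n" using B Wc by auto
  ultimately obtain C where C: "B \<subseteq> C" "C \<subseteq> carrier_vec n" "finite C" "lin_indpt C" "span C = carrier_vec n"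
    using B(3) by (rule independent_set_extends_to_basis_of_subspace)
  have cardC: "card C = n"
    using dim_basis[of C] C dim_is_n by (auto simp: basis_def)
  obtain bs where bs: "set bs = B" "distinct bs" using B finite_distinct_list by blast
  obtain cs where cs: "set cs = C - B" "distinct cs"
    using C finite_distinct_list[of "C - B"] by blast
  define k where "k = length bs"
  define P where "P = mat_of_cols n (bs @ cs)"
  have setC: "set (bs @ cs) = C" and dist: "distinct (bs @ cs)"
    using bs cs C by auto
  have len: "length (bs @ cs) = n" using distinct_card[OF dist] setC cardC by simp
  have P: "P \<in> carrier_mat n n" unfolding P_def using len by (metis mat_of_cols_carrier(1))
  have cols: "cols P = bs @ cs" unfolding P_def using C setC by (intro cols_mat_of_cols) auto
  have "det P \<noteq> 0"
  proof
    assume "det P = 0"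
    then obtain v where "v \<in> carrier_vec n" "v \<noteq> 0\<^sub>v n" "P *\<^sub>v v = 0\<^sub>v n"
      using det_0_iff_vec_prod_zero_field[OF P] by auto
    from lin_depI[OF P this] dist cols setC C show False by simp
  qed
  then obtain Q where Q: "Q \<in> carrier_mat n n" "Q * P = 1\<^sub>m n" "P * Q = 1\<^sub>m n"
    using det_non_zero_imp_unit[OF P, of undefined] by (auto simp: Units_def ring_mat_def)
  have colB: "col P j \<in> B" if "j < k" for j
  proof -
    have "cols P ! j = col P j" using that P len unfolding k_def by (intro cols_nth) auto
    then show ?thesis using that bs cols nth_mem[of j bs] unfolding k_def by (simp add: nth_append)
  qed
  have Qw: "(Q *\<^sub>v w) $ i = 0" if w: "w \<in> W" and i: "k \<le> i" "i < n" for w i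
  proof -
    obtain a where a: "lincomb a B = w"
      using finite_in_span[OF B(2)] B Wc w by (metis subset_trans)
    \<comment> \<open>The coordinates of \<open>w\<close> in the basis \<open>C\<close>: those of the added vectors are zero.\<close>
    let ?a = "\<lambda>v. if v \<in> B then a v else 0"
    have wP: "w = P *\<^sub>v vec n (\<lambda>j. ?a (col P j))"
    proof -
      have "w = lincomb ?a C"
      proof (rule eq_vecI)
        show "dim_vec w = dim_vec (lincomb ?a C)"
          using subsetD[OF Wc w] lincomb_dim[OF C(3,2), of ?a] by simp
        fix i assume "i < dim_vec (lincomb ?a C)"
        then have i: "i < n" using lincomb_dim[OF C(3,2), of ?a] by simp
        have "w $ i = (\<Sum>x\<in>B. a x * x $ i)"
          unfolding a[symmetric] using lincomb_index[OF i, of B a] B Wc by auto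
        also have "\<dots> = (\<Sum>x\<in>C. ?a x * x $ i)"
          by (rule sum.mono_neutral_cong_left) (use C in auto)
        also have "\<dots> = lincomb ?a C $ i" using lincomb_index[OF i, of C ?a] C by auto
        finally show "w $ i = lincomb ?a C $ i" .
      qed
      then show ?thesis using mat_mult_eq_lincomb[OF P, of ?a] dist cols setC by simp
    qed
    have "Q *\<^sub>v w = vec n (\<lambda>j. ?a (col P j))"
      unfolding wP using P Q by (simp flip: assoc_mult_mat_vec)
    moreover have "col P i \<in> C - B"
      using i P len cols cols_nth[of i P] cs unfolding k_def
      by (metis carrier_matD(2) length_append nat_add_left_cancel_less le_add_diff_inverse
          nth_append_length_plus nth_mem)
    ultimately show ?thesis using i by simp
  qed
  have "k \<noteq> 0" using B W0 bs span_empty unfolding k_def by (metis length_0_conv list.set(1))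
  moreover have "k \<noteq> n"
  proof
    assume "k = n"
    then have "cs = []" using len unfolding k_def by simp
    then have "B = C" using cs C by auto
    then show False using B C Wn by simp
  qed
  moreover have "k \<le> n" using len unfolding k_def by simp
  ultimately show ?thesis
    by (intro that[OF P Q, of k]) (use colB Qw B(1) in auto)
qed

end

section \<open>Characters of representations are virtual characters\<close>

text \<open>
  Two integer combinations over different finite sets of representations are added after both have
  been extended by zero coefficients to the union.
\<close>

lemma sum_of_int_coeff_extend:
  assumes "finite S" "R \<subseteq> S"
  shows "(\<Sum>\<rho>\<in>R. of_int (c \<rho>) * f \<rho>) = (\<Sum>\<rho>\<in>S. of_int (if \<rho> \<in> R then c \<rho> else 0) * (f \<rho> :: complex))"
  using assms by (intro sum.mono_neutral_cong_left) auto

lemma virtual_char_zero: "virtual_char G (\<lambda>g. 0)"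
  unfolding virtual_char_def by (intro exI[of _ "{}"]) auto

lemma virtual_char_add:
  assumes "virtual_char G X" "virtual_char G Y"
  shows "virtual_char G (\<lambda>g. X g + Y g)"
proof -
  obtain R c where R: "finite R" "\<forall>\<rho>\<in>R. \<exists>n. simple_rep G n \<rho>"
    "X = (\<lambda>g. \<Sum>\<rho>\<in>R. of_int (c \<rho>) * character G \<rho> g)"
    using assms(1) unfolding virtual_char_def by blast
  obtain S d where S: "finite S" "\<forall>\<rho>\<in>S. \<exists>n. simple_rep G n \<rho>"
    "Y = (\<lambda>g. \<Sum>\<rho>\<in>S. of_int (d \<rho>) * character G \<rho> g)"
    using assms(2) unfolding virtual_char_def by blast
  let ?c = "\<lambda>\<rho>. (if \<rho> \<in> R then c \<rho> else 0) + (if \<rho> \<in> S then d \<rho> else 0)"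
  have "(\<lambda>g. X g + Y g) = (\<lambda>g. \<Sum>\<rho>\<in>R \<union> S. of_int (?c \<rho>) * character G \<rho> g)"
    unfolding R(3) S(3)
    using R(1) S(1)
    by (simp add: sum_of_int_coeff_extend[of "R \<union> S" R] sum_of_int_coeff_extend[of "R \<union> S" S]
        sum.distrib distrib_right del: of_int_add) (simp add: sum.distrib distrib_right)
  then show ?thesis
    unfolding virtual_char_def using R(1,2) S(1,2) by (intro exI[of _ "R \<union> S"] exI[of _ ?c]) auto
qed

lemma virtual_char_scale:
  assumes "virtual_char G X"
  shows "virtual_char G (\<lambda>g. of_int a * X g)"
proof -
  obtain R c where R: "finite R" "\<forall>\<rho>\<in>R. \<exists>n. simple_rep G n \<rho>"
    "X = (\<lambda>g. \<Sum>\<rho>\<in>R. of_int (c \<rho>) * character G \<rho> g)"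
    using assms(1) unfolding virtual_char_def by blast
  then show ?thesis
    unfolding virtual_char_def
    by (intro exI[of _ R] exI[of _ "\<lambda>\<rho>. a * c \<rho>"]) (auto simp: sum_distrib_left mult.assoc)
qed

lemma virtual_char_lincomb:
  assumes "\<And>i. i \<in> I \<Longrightarrow> virtual_char G (X i)"
  shows "virtual_char G (\<lambda>g. \<Sum>i\<in>I. of_int (a i) * X i g)"
  using assms
  by (induction I rule: infinite_finite_induct)
     (auto intro!: virtual_char_zero virtual_char_add virtual_char_scale)

lemma character_rep: "matrix_rep G n \<rho> \<Longrightarrow> g \<in> carrier G \<Longrightarrow> character G \<rho> g = (\<Sum>i<n. \<rho> g $$ (i, i))"
  by (auto simp: character_def matrix_rep_def dest!: bspec)

lemma trace_comm:
  fixes A B :: "complex mat"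
  assumes "A \<in> carrier_mat n n" "B \<in> carrier_mat n n"
  shows "(\<Sum>i<n. (A * B) $$ (i, i)) = (\<Sum>i<n. (B * A) $$ (i, i))"
proof -
  have "(\<Sum>i<n. (A * B) $$ (i, i)) = (\<Sum>i<n. \<Sum>j<n. A $$ (i, j) * B $$ (j, i))"
    using assms by (intro sum.cong) (auto simp: scalar_prod_def lessThan_atLeast0)
  also have "\<dots> = (\<Sum>j<n. \<Sum>i<n. A $$ (i, j) * B $$ (j, i))" by (rule sum.swap)
  also have "\<dots> = (\<Sum>i<n. (B * A) $$ (i, i))"
    using assms by (intro sum.cong) (auto simp: scalar_prod_def lessThan_atLeast0 mult.commute)
  finally show ?thesis .
qed

lemma matrix_rep_conjugate:
  assumes \<rho>: "matrix_rep G n \<rho>" and P: "P \<in> carrier_mat n n" and Q: "Q \<in> carrier_mat n n"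
    and QP: "Q * P = 1\<^sub>m n" and PQ: "P * Q = 1\<^sub>m n"
  defines "\<sigma> \<equiv> \<lambda>g. Q * \<rho> g * P"
  shows "matrix_rep G n \<sigma>" and "character G \<sigma> = character G \<rho>"
proof -
  have c: "\<rho> g \<in> carrier_mat n n" if "g \<in> carrier G" for g
    using \<rho> that by (auto simp: matrix_rep_def)
  have mult: "Q * (A * B) * P = (Q * A * P) * (Q * B * P)"
    if AB: "A \<in> carrier_mat n n" "B \<in> carrier_mat n n" for A B
  proof -
    have "(Q * A * P) * (Q * B * P) = Q * A * (P * Q) * B * P"
      using AB P Q by (simp add: assoc_mult_mat[of _ n n _ n _ n] mult_carrier_mat[of _ n n _ n])
    also have "\<dots> = Q * (A * B) * P"
      using AB P Q PQ by (simp add: assoc_mult_mat[of _ n n _ n _ n])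
    finally show ?thesis ..
  qed
  show rep: "matrix_rep G n \<sigma>"
    using \<rho> P Q QP unfolding matrix_rep_def \<sigma>_def
    by (auto simp: mult intro!: mult_carrier_mat)
  show "character G \<sigma> = character G \<rho>"
  proof
    fix g
    show "character G \<sigma> g = character G \<rho> g"
    proof (cases "g \<in> carrier G")
      case True
      have "(\<Sum>i<n. \<sigma> g $$ (i, i)) = (\<Sum>i<n. (P * (Q * \<rho> g)) $$ (i, i))"
        unfolding \<sigma>_def using c[OF True] P Q by (intro trace_comm) auto
      also have "P * (Q * \<rho> g) = \<rho> g"
        using c[OF True] P Q PQ by (simp flip: assoc_mult_mat)
      finally show ?thesis using character_rep[OF rep True] character_rep[OF \<rho> True] by simp
    qed (simp add: character_def)
  qed
qed

text \<open>
  The diagonal blocks are the subrepresentation on the first \<open>k\<close> coordinates and the quotient by it;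
  on the diagonal of a product the two blocks do not interact.
\<close>

lemma block_triangular_rep:
  assumes \<rho>: "matrix_rep G n \<rho>" and k: "k \<le> n"
    and zero: "\<And>g i j. g \<in> carrier G \<Longrightarrow> k \<le> i \<Longrightarrow> i < n \<Longrightarrow> j < k \<Longrightarrow> \<rho> g $$ (i, j) = 0"
  defines "\<sigma> \<equiv> \<lambda>g. mat k k (\<lambda>(i, j). \<rho> g $$ (i, j))"
    and "\<tau> \<equiv> \<lambda>g. mat (n - k) (n - k) (\<lambda>(i, j). \<rho> g $$ (i + k, j + k))"
  shows "matrix_rep G k \<sigma>" and "matrix_rep G (n - k) \<tau>"
    and "character G \<rho> = (\<lambda>g. character G \<sigma> g + character G \<tau> g)"
proof -
  have split: "(\<Sum>l<n. f l) = (\<Sum>l<k. f l) + (\<Sum>l<n-k. f (l + k))" for f :: "nat \<Rightarrow> complex"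
    using sum.shift_bounds_nat_ivl[of f 0 k "n-k"] k
      sum.atLeastLessThan_concat[of 0 k n f]
    by (simp add: lessThan_atLeast0)
  have entry: "\<rho> (g \<otimes>\<^bsub>G\<^esub> h) $$ (i, j) = (\<Sum>l<n. \<rho> g $$ (i, l) * \<rho> h $$ (l, j))"
    if "g \<in> carrier G" "h \<in> carrier G" "i < n" "j < n" for g h i j
  proof -
    have "\<rho> g \<in> carrier_mat n n" "\<rho> h \<in> carrier_mat n n" "\<rho> (g \<otimes>\<^bsub>G\<^esub> h) = \<rho> g * \<rho> h"
      using \<rho> that by (auto simp: matrix_rep_def)
    then show ?thesis using that by (simp add: scalar_prod_def lessThan_atLeast0)
  qed
  have one: "\<rho> \<one>\<^bsub>G\<^esub> = 1\<^sub>m n" using \<rho> by (simp add: matrix_rep_def)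
  have \<sigma>mult: "\<sigma> (g \<otimes>\<^bsub>G\<^esub> h) = \<sigma> g * \<sigma> h" if gh: "g \<in> carrier G" "h \<in> carrier G" for g h
    by (rule eq_matI)
       (use k gh zero in \<open>auto simp: \<sigma>_def entry split scalar_prod_def lessThan_atLeast0[symmetric] intro!: sum.neutral\<close>)
  have \<tau>mult: "\<tau> (g \<otimes>\<^bsub>G\<^esub> h) = \<tau> g * \<tau> h" if gh: "g \<in> carrier G" "h \<in> carrier G" for g h
    by (rule eq_matI)
       (use k gh zero in \<open>auto simp: \<tau>_def entry split scalar_prod_def lessThan_atLeast0[symmetric] intro!: sum.neutral\<close>)
  show \<sigma>: "matrix_rep G k \<sigma>"
    unfolding matrix_rep_def using \<sigma>mult k by (auto simp: \<sigma>_def one intro!: eq_matI)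
  show \<tau>: "matrix_rep G (n - k) \<tau>"
    unfolding matrix_rep_def using \<tau>mult k by (auto simp: \<tau>_def one intro!: eq_matI)
  show "character G \<rho> = (\<lambda>g. character G \<sigma> g + character G \<tau> g)"
  proof
    fix g
    show "character G \<rho> g = character G \<sigma> g + character G \<tau> g"
    proof (cases "g \<in> carrier G")
      case True
      then show ?thesis
        by (simp add: character_rep[OF \<rho>] character_rep[OF \<sigma>] character_rep[OF \<tau>] split)
           (simp add: \<sigma>_def \<tau>_def)
    qed (simp add: character_def)
  qed
qed

text \<open>
  This is a composition series, built by induction on the dimension: a representation that is not
  simple has a proper invariant subspace, and in an adapted basis its character is the sum of the
  characters of the subspace and of the quotient.
\<close>

lemma virtual_char_character:
  assumes "matrix_rep G n \<rho>"
  shows "virtual_char G (character G \<rho>)"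
  using assms
proof (induction n arbitrary: \<rho> rule: less_induct)
  case (less n)
  note \<rho> = less.prems
  consider "n = 0" | "simple_rep G n \<rho>" | "0 < n" "\<not> simple_rep G n \<rho>" by auto
  then show ?case
  proof cases
    case 1
    then have "character G \<rho> = (\<lambda>g. 0)"
      using character_rep[OF \<rho>] by (auto simp: character_def)
    then show ?thesis by (simp add: virtual_char_zero)
  next
    case 2
    then show ?thesis
      unfolding virtual_char_def by (intro exI[of _ "{\<rho>}"] exI[of _ "\<lambda>_. 1"]) auto
  next
    case 3
    interpret vec_space "TYPE(complex)" n .
    obtain W where W: "VectorSpace.subspace class_ring W V"
      and inv: "\<And>g w. g \<in> carrier G \<Longrightarrow> w \<in> W \<Longrightarrow> \<rho> g *\<^sub>v w \<in> W"
      and W': "W \<noteq> {0\<^sub>v n}" "W \<noteq> carrier_vec n"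
      using 3 \<rho> unfolding simple_rep_def by blast
    obtain P Q k where PQ: "P \<in> carrier_mat n n" "Q \<in> carrier_mat n n"
      "Q * P = 1\<^sub>m n" "P * Q = 1\<^sub>m n" and k: "0 < k" "k < n"
      and PW: "\<And>j. j < k \<Longrightarrow> col P j \<in> W"
      and QW: "\<And>w i. w \<in> W \<Longrightarrow> k \<le> i \<Longrightarrow> i < n \<Longrightarrow> (Q *\<^sub>v w) $ i = 0"
      using basis_adapted_to_subspace[OF W W'] by metis
    define \<sigma> where "\<sigma> = (\<lambda>g. Q * \<rho> g * P)"
    note conj = matrix_rep_conjugate[OF \<rho> PQ, folded \<sigma>_def]
    have zero: "\<sigma> g $$ (i, j) = 0" if "g \<in> carrier G" "k \<le> i" "i < n" "j < k" for g i j
    proof -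
      have c: "\<rho> g \<in> carrier_mat n n" using \<rho> that by (auto simp: matrix_rep_def)
      have "\<sigma> g $$ (i, j) = row (Q * \<rho> g) i \<bullet> col P j"
        unfolding \<sigma>_def using that k c PQ by (intro index_mult_mat) auto
      also have "\<dots> = ((Q * \<rho> g) *\<^sub>v col P j) $ i"
        using that k c PQ by auto
      also have "(Q * \<rho> g) *\<^sub>v col P j = Q *\<^sub>v (\<rho> g *\<^sub>v col P j)"
        using that k c PQ by (intro assoc_mult_mat_vec) auto
      finally show ?thesis using QW[OF inv[OF that(1) PW[OF that(4)]] that(2,3)] by simp
    qed
    note block = block_triangular_rep[OF conj(1) less_imp_le[OF k(2)] zero, simplified]
    have "virtual_char G (character G \<sigma>)"
      using virtual_char_add[OF less.IH[OF k(2) block(1)] less.IH[OF _ block(2)]] k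
      by (simp add: block(3))
    then show ?thesis using conj(2) by simp
  qed
qed

section \<open>Restriction and induction\<close>

text \<open>
  Matrix positions below \<open>t * n\<close> are read as pairs of a block number and a place in the block.
\<close>

lemma sum_divmod:
  fixes t n :: nat
  shows "(\<Sum>c<t * n. f (c div n) (c mod n)) = (\<Sum>l<t. \<Sum>m<n. f l m :: complex)"
proof -
  have "(\<Sum>c = l * n..<l * n + n. f (c div n) (c mod n)) = (\<Sum>m<n. f l m)" for l
    using sum.shift_bounds_nat_ivl[of "\<lambda>c. f (c div n) (c mod n)" 0 "l * n" n]
    by (simp add: lessThan_atLeast0 add.commute)
  then show ?thesis
    using sum.nat_group[of "\<lambda>c. f (c div n) (c mod n)" n t] by simp
qed

context group
begin

lemma mult_inv_cancel_left [simp]: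
  assumes "x \<in> carrier G" "y \<in> carrier G"
  shows "x \<otimes> (inv x \<otimes> y) = y" and "inv x \<otimes> (x \<otimes> y) = y"
  using assms by (simp_all flip: m_assoc)

lemma character_class_function:
  assumes \<rho>: "matrix_rep G n \<rho>" and x: "x \<in> carrier G" and g: "g \<in> carrier G"
  shows "character G \<rho> (inv x \<otimes> g \<otimes> x) = character G \<rho> g"
proof -
  have c: "\<rho> y \<in> carrier_mat n n" if "y \<in> carrier G" for y
    using \<rho> that by (auto simp: matrix_rep_def)
  have m: "\<rho> (y \<otimes> z) = \<rho> y * \<rho> z" if "y \<in> carrier G" "z \<in> carrier G" for y z
    using \<rho> that by (auto simp: matrix_rep_def)
  have "(\<Sum>i<n. \<rho> (inv x \<otimes> g \<otimes> x) $$ (i, i)) = (\<Sum>i<n. (\<rho> x * \<rho> (inv x \<otimes> g)) $$ (i, i))"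
    using x g by (simp add: m[of "inv x \<otimes> g" x] trace_comm[OF c c, of "inv x \<otimes> g" x])
  also have "\<rho> x * \<rho> (inv x \<otimes> g) = \<rho> g"
    using x g by (simp flip: m)
  finally show ?thesis using x g by (simp add: character_rep[OF \<rho>])
qed

text \<open>
  A choice function applied to the set of all representatives of a coset depends on the coset only,
  so its range meets every left coset exactly once.
\<close>

lemma left_transversal:
  assumes H: "subgroup H G"
  obtains R where "R \<subseteq> carrier G" "\<And>g. g \<in> carrier G \<Longrightarrow> \<exists>!x. x \<in> R \<and> inv x \<otimes> g \<in> H"
proof -
  interpret H: subgroup H G by fact
  define rep where "rep g = (SOME x. x \<in> carrier G \<and> inv x \<otimes> g \<in> H)" for g
  have rep: "rep g \<in> carrier G" "inv (rep g) \<otimes> g \<in> H" if "g \<in> carrier G" for g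
    using someI[of "\<lambda>x. x \<in> carrier G \<and> inv x \<otimes> g \<in> H" g] that by (auto simp: rep_def)
  have step: "inv x \<otimes> b \<in> H" if "inv x \<otimes> a \<in> H" "inv a \<otimes> b \<in> H"
    "x \<in> carrier G" "a \<in> carrier G" "b \<in> carrier G" for x a b
    using H.m_closed[OF that(1,2)] that(3-) by (simp add: m_assoc)
  have sym: "inv b \<otimes> a \<in> H" if "inv a \<otimes> b \<in> H" "a \<in> carrier G" "b \<in> carrier G" for a b
    using H.m_inv_closed[OF that(1)] that(2-) by (simp add: inv_mult_group)
  have eq: "rep a = rep b" if "inv a \<otimes> b \<in> H" "a \<in> carrier G" "b \<in> carrier G" for a b
  proof -
    have "(\<lambda>x. x \<in> carrier G \<and> inv x \<otimes> a \<in> H) = (\<lambda>x. x \<in> carrier G \<and> inv x \<otimes> b \<in> H)"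
      using step[of _ a b] step[of _ b a] sym that by blast
    then show ?thesis unfolding rep_def by simp
  qed
  have rr: "rep (rep a) = rep a" if "a \<in> carrier G" for a
    using eq rep[OF that] that by blast
  show ?thesis
  proof (rule that[of "rep ` carrier G"])
    show "rep ` carrier G \<subseteq> carrier G" using rep by auto
    fix g assume g: "g \<in> carrier G"
    show "\<exists>!x. x \<in> rep ` carrier G \<and> inv x \<otimes> g \<in> H"
    proof (rule ex1I[of _ "rep g"])
      show "rep g \<in> rep ` carrier G \<and> inv (rep g) \<otimes> g \<in> H" using rep g by auto
      fix x assume x: "x \<in> rep ` carrier G \<and> inv x \<otimes> g \<in> H"
      then obtain a where a: "a \<in> carrier G" "x = rep a" by auto
      then show "x = rep g" using eq[of x g] rr rep x g by auto
    qed
  qed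
qed

lemma subgroup_rep:
  assumes "subgroup H G" "matrix_rep G n \<rho>"
  shows "matrix_rep (G\<lparr>carrier := H\<rparr>) n \<rho>"
  using assms subgroup.subset[OF assms(1)] by (auto simp: matrix_rep_def subset_iff)

lemma virtual_char_restrict:
  assumes H: "subgroup H G" and X: "virtual_char G X"
  shows "virtual_char (G\<lparr>carrier := H\<rparr>) (restrict_char H X)"
proof -
  obtain R c where R: "finite R" "\<forall>\<rho>\<in>R. \<exists>n. simple_rep G n \<rho>"
    "X = (\<lambda>g. \<Sum>\<rho>\<in>R. of_int (c \<rho>) * character G \<rho> g)"
    using X unfolding virtual_char_def by blast
  have "restrict_char H X = (\<lambda>g. \<Sum>\<rho>\<in>R. of_int (c \<rho>) * character (G\<lparr>carrier := H\<rparr>) \<rho> g)"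
    using subgroup.subset[OF H] unfolding R(3) by (auto simp: restrict_char_def character_def fun_eq_iff)
  moreover have "virtual_char (G\<lparr>carrier := H\<rparr>) (character (G\<lparr>carrier := H\<rparr>) \<rho>)" if "\<rho> \<in> R" for \<rho>
  proof -
    obtain n where "matrix_rep G n \<rho>" using R(2) \<open>\<rho> \<in> R\<close> unfolding simple_rep_def by blast
    then show ?thesis by (intro virtual_char_character subgroup_rep[OF H])
  qed
  ultimately show ?thesis by (simp add: virtual_char_lincomb)
qed

text \<open>
  The summand in Frobenius' formula depends only on the left coset of \<open>H\<close> containing \<open>x\<close>, because
  \<open>X\<close> is invariant under conjugation in \<open>H\<close>.  Hence the average over \<open>G\<close> is a sum over
  representatives, which is the form in which the trace of a block matrix appears.
\<close>

lemma induced_char_eq_transversal_sum: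
  assumes fin: "finite (carrier G)" and H: "subgroup H G"
    and R: "R \<subseteq> carrier G" "\<And>g. g \<in> carrier G \<Longrightarrow> \<exists>!x. x \<in> R \<and> inv x \<otimes> g \<in> H"
    and X: "\<And>h u. h \<in> H \<Longrightarrow> u \<in> H \<Longrightarrow> X (inv h \<otimes> u \<otimes> h) = X u"
    and g: "g \<in> carrier G"
  shows "induced_char G H X g =
    (\<Sum>x\<in>R. if inv x \<otimes> g \<otimes> x \<in> H then X (inv x \<otimes> g \<otimes> x) else 0)"
proof -
  interpret H: subgroup H G by fact
  let ?F = "\<lambda>x. if inv x \<otimes> g \<otimes> x \<in> H then X (inv x \<otimes> g \<otimes> x) else 0"
  have finH: "finite H" using fin H.subset finite_subset by blast
  then have cardH: "card H \<noteq> 0" using H.one_closed by (metis card_0_eq empty_iff)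
  have bij: "bij_betw (\<lambda>(x, h). x \<otimes> h) (R \<times> H) (carrier G)"
    unfolding bij_betw_def
  proof
    show "inj_on (\<lambda>(x, h). x \<otimes> h) (R \<times> H)"
    proof (rule inj_onI, clarify)
      fix x h y u assume a: "x \<in> R" "h \<in> H" "y \<in> R" "u \<in> H" "x \<otimes> h = y \<otimes> u"
      then have c: "x \<in> carrier G" "y \<in> carrier G" "h \<in> carrier G" "u \<in> carrier G"
        using R(1) H.subset by auto
      have "inv x \<otimes> (x \<otimes> h) \<in> H" "inv y \<otimes> (x \<otimes> h) \<in> H"
        using a(2,4) c by (simp, unfold a(5), simp)
      then have "x = y" using R(2)[of "x \<otimes> h"] a(1,3) c by auto
      then show "x = y \<and> h = u" using a(5) c by simp
    qed
    show "(\<lambda>(x, h). x \<otimes> h) ` (R \<times> H) = carrier G"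
    proof
      show "(\<lambda>(x, h). x \<otimes> h) ` (R \<times> H) \<subseteq> carrier G"
        using R(1) H.subset by auto
      show "carrier G \<subseteq> (\<lambda>(x, h). x \<otimes> h) ` (R \<times> H)"
      proof
        fix y assume y: "y \<in> carrier G"
        then obtain x where x: "x \<in> R" "inv x \<otimes> y \<in> H" using R(2) by blast
        have "y = x \<otimes> (inv x \<otimes> y)" using x(1) R(1) y by auto
        then show "y \<in> (\<lambda>(x, h). x \<otimes> h) ` (R \<times> H)" using x by force
      qed
    qed
  qed
  have F: "?F (x \<otimes> h) = ?F x" if x: "x \<in> R" and h: "h \<in> H" for x h
  proof -
    have c: "x \<in> carrier G" "h \<in> carrier G" using x h R(1) H.subset by auto
    let ?u = "inv x \<otimes> g \<otimes> x"
    have e: "inv (x \<otimes> h) \<otimes> g \<otimes> (x \<otimes> h) = inv h \<otimes> ?u \<otimes> h"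
      using c g by (simp add: inv_mult_group m_assoc)
    have "?u = h \<otimes> (inv h \<otimes> ?u \<otimes> h) \<otimes> inv h"
      using c g by (simp add: m_assoc)
    then have "inv h \<otimes> ?u \<otimes> h \<in> H \<longleftrightarrow> ?u \<in> H"
      using h by (metis H.m_closed H.m_inv_closed)
    then show ?thesis using X[OF h] by (simp add: e)
  qed
  have "(\<Sum>x | x \<in> carrier G \<and> inv x \<otimes> g \<otimes> x \<in> H. X (inv x \<otimes> g \<otimes> x)) = (\<Sum>y\<in>carrier G. ?F y)"
    using fin by (intro sum.mono_neutral_cong_left) auto
  also have "\<dots> = (\<Sum>(x, h)\<in>R \<times> H. ?F (x \<otimes> h))"
    using sum.reindex_bij_betw[OF bij, of ?F] by (simp only: case_prod_unfold)
  also have "\<dots> = (\<Sum>x\<in>R. \<Sum>h\<in>H. ?F x)"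
    unfolding sum.cartesian_product[symmetric] by (intro sum.cong refl F)
  also have "\<dots> = of_nat (card H) * (\<Sum>x\<in>R. ?F x)"
    by (simp add: sum_distrib_left)
  finally show ?thesis using g cardH by (simp add: induced_char_def)
qed

text \<open>
  The induced representation consists of blocks indexed by coset representatives; the block at \<open>(x, y)\<close>
  is \<open>\<rho> (x\<inverse> g y)\<close> if this element lies in \<open>H\<close> and zero otherwise.  In a product of two such
  matrices only one intermediate representative contributes, namely that of the coset of \<open>g\<inverse> x\<close>.
\<close>

lemma induced_char_is_character:
  assumes fin: "finite (carrier G)" and H: "subgroup H G"
    and \<rho>: "matrix_rep (G\<lparr>carrier := H\<rparr>) n \<rho>"
  obtains N \<sigma> where "matrix_rep G N \<sigma>"
    "character G \<sigma> = induced_char G H (character (G\<lparr>carrier := H\<rparr>) \<rho>)"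
proof -
  interpret H: subgroup H G by fact
  interpret GH: group "G\<lparr>carrier := H\<rparr>" using H by (rule subgroup_imp_group)
  let ?\<chi> = "character (G\<lparr>carrier := H\<rparr>) \<rho>"
  obtain R where R: "R \<subseteq> carrier G" "\<And>g. g \<in> carrier G \<Longrightarrow> \<exists>!x. x \<in> R \<and> inv x \<otimes> g \<in> H"
    using left_transversal[OF H] by blast
  obtain xs where xs: "set xs = R" "distinct xs"
    using finite_distinct_list finite_subset[OF R(1) fin] by blast
  define t where "t = length xs"
  have sumR: "(\<Sum>l<t. f (xs ! l)) = (\<Sum>x\<in>R. f x)" for f :: "'a \<Rightarrow> complex"
    using sum.reindex_bij_betw[OF bij_betw_nth[OF xs(2) refl refl], of f] xs(1) by (simp add: t_def)
  define E where "E g x y i j = (if inv x \<otimes> g \<otimes> y \<in> H then \<rho> (inv x \<otimes> g \<otimes> y) $$ (i, j) else 0)" for g x y i j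
  define \<sigma> where "\<sigma> g = mat (t * n) (t * n) (\<lambda>(a, b). E g (xs ! (a div n)) (xs ! (b div n)) (a mod n) (b mod n))" for g
  have \<rho>c: "\<rho> h \<in> carrier_mat n n" if "h \<in> H" for h using \<rho> that by (auto simp: matrix_rep_def)
  have \<rho>m: "\<rho> (h \<otimes> u) = \<rho> h * \<rho> u" if "h \<in> H" "u \<in> H" for h u
    using \<rho> that by (auto simp: matrix_rep_def)
  have \<rho>1: "\<rho> \<one> = 1\<^sub>m n" using \<rho> by (auto simp: matrix_rep_def)
  have Emult: "E (g \<otimes> g') x y i j = (\<Sum>z\<in>R. \<Sum>m<n. E g x z i m * E g' z y m j)"
    if g: "g \<in> carrier G" "g' \<in> carrier G" and xy: "x \<in> R" "y \<in> R" and ij: "i < n" "j < n" for g g' x y i j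
  proof -
    have c: "x \<in> carrier G" "y \<in> carrier G" using xy R(1) by auto
    have flip: "inv x \<otimes> g \<otimes> z \<in> H \<longleftrightarrow> inv z \<otimes> (inv g \<otimes> x) \<in> H" if "z \<in> carrier G" for z
    proof -
      have e: "inv (inv x \<otimes> g \<otimes> z) = inv z \<otimes> (inv g \<otimes> x)"
        using g c that by (simp add: inv_mult_group m_assoc)
      show ?thesis unfolding e[symmetric]
        using g c that H.m_inv_closed by (metis inv_inv inv_closed m_closed)
    qed
    have ex1: "\<exists>!z. z \<in> R \<and> inv z \<otimes> (inv g \<otimes> x) \<in> H" using R(2) g c by simp
    then obtain z where z: "z \<in> R" "inv z \<otimes> (inv g \<otimes> x) \<in> H" by blast
    then have z_unique: "w = z" if "w \<in> R" "inv w \<otimes> (inv g \<otimes> x) \<in> H" for w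
      using ex1 that by blast
    have zc: "z \<in> carrier G" using z R(1) by auto
    have hz: "inv x \<otimes> g \<otimes> z \<in> H" using flip[OF zc] z by simp
    have "E g x w i m * E g' w y m j = 0" if "w \<in> R - {z}" for w m
      using flip[of w] z_unique[of w] that R(1) by (auto simp: E_def)
    then have "(\<Sum>w\<in>R. \<Sum>m<n. E g x w i m * E g' w y m j) = (\<Sum>w\<in>{z}. \<Sum>m<n. E g x w i m * E g' w y m j)"
      using z(1) by (intro sum.mono_neutral_right finite_subset[OF R(1) fin]) auto
    also have "\<dots> = (\<Sum>m<n. E g x z i m * E g' z y m j)" by simp
    also have "\<dots> = E (g \<otimes> g') x y i j"
    proof -
      have prod: "inv x \<otimes> (g \<otimes> g') \<otimes> y = (inv x \<otimes> g \<otimes> z) \<otimes> (inv z \<otimes> g' \<otimes> y)"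
        using g c zc by (simp add: m_assoc)
      have iff: "inv x \<otimes> (g \<otimes> g') \<otimes> y \<in> H \<longleftrightarrow> inv z \<otimes> g' \<otimes> y \<in> H"
      proof
        assume "inv z \<otimes> g' \<otimes> y \<in> H"
        then show "inv x \<otimes> (g \<otimes> g') \<otimes> y \<in> H" using hz by (simp add: prod)
      next
        assume a: "inv x \<otimes> (g \<otimes> g') \<otimes> y \<in> H"
        have "inv z \<otimes> g' \<otimes> y = inv (inv x \<otimes> g \<otimes> z) \<otimes> (inv x \<otimes> (g \<otimes> g') \<otimes> y)"
          using g c zc by (simp add: m_assoc inv_mult_group)
        then show "inv z \<otimes> g' \<otimes> y \<in> H" using a hz by (metis H.m_closed H.m_inv_closed)
      qed
      show ?thesis
      proof (cases "inv z \<otimes> g' \<otimes> y \<in> H")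
        case True
        then have "E (g \<otimes> g') x y i j = (\<rho> (inv x \<otimes> g \<otimes> z) * \<rho> (inv z \<otimes> g' \<otimes> y)) $$ (i, j)"
          unfolding E_def iff by (simp add: prod \<rho>m[OF hz])
        also have "\<dots> = (\<Sum>m<n. E g x z i m * E g' z y m j)"
          using \<rho>c[OF hz] \<rho>c[OF True] ij hz True
          by (simp add: E_def scalar_prod_def lessThan_atLeast0)
        finally show ?thesis by simp
      next
        case False
        then show ?thesis using iff by (simp add: E_def)
      qed
    qed
    finally show ?thesis by simp
  qed
  have idx: "a mod n < n" "xs ! (a div n) \<in> R" if "a < t * n" for a
  proof -
    have "0 < n" using that by (cases n) auto
    then show "a mod n < n" by simp
    have "a div n < t" using that by (simp add: less_mult_imp_div_less)
    then show "xs ! (a div n) \<in> R" using xs(1) by (auto simp: t_def)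
  qed
  have "\<sigma> (g \<otimes> g') = \<sigma> g * \<sigma> g'" if g: "g \<in> carrier G" "g' \<in> carrier G" for g g'
  proof (rule eq_matI)
    fix a b assume "a < dim_row (\<sigma> g * \<sigma> g')" "b < dim_col (\<sigma> g * \<sigma> g')"
    then have ab: "a < t * n" "b < t * n" by (auto simp: \<sigma>_def)
    define x y i j where "x = xs ! (a div n)" "y = xs ! (b div n)" "i = a mod n" "j = b mod n"
    have "(\<sigma> g * \<sigma> g') $$ (a, b)
        = (\<Sum>c<t * n. E g x (xs ! (c div n)) i (c mod n) * E g' (xs ! (c div n)) y (c mod n) j)"
      using ab by (simp add: \<sigma>_def scalar_prod_def lessThan_atLeast0 x_y_i_j_def)
    also have "\<dots> = (\<Sum>l<t. \<Sum>m<n. E g x (xs ! l) i m * E g' (xs ! l) y m j)"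
      by (rule sum_divmod)
    also have "\<dots> = (\<Sum>z\<in>R. \<Sum>m<n. E g x z i m * E g' z y m j)"
      by (rule sumR)
    also have "\<dots> = E (g \<otimes> g') x y i j"
      using Emult[OF g] idx ab by (simp add: x_y_i_j_def)
    finally show "\<sigma> (g \<otimes> g') $$ (a, b) = (\<sigma> g * \<sigma> g') $$ (a, b)"
      using ab by (simp add: \<sigma>_def x_y_i_j_def)
  qed (auto simp: \<sigma>_def)
  moreover have "\<sigma> \<one> = 1\<^sub>m (t * n)"
  proof (rule eq_matI)
    fix a b assume "a < dim_row (1\<^sub>m (t * n) :: complex mat)" "b < dim_col (1\<^sub>m (t * n) :: complex mat)"
    then have ab: "a < t * n" "b < t * n" by auto
    let ?x = "xs ! (a div n)" and ?y = "xs ! (b div n)"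
    have c: "?x \<in> carrier G" "?y \<in> carrier G" using idx ab R(1) by auto
    have lt: "a div n < t" "b div n < t" using ab by (simp_all add: less_mult_imp_div_less)
    have mem: "inv ?x \<otimes> ?y \<in> H \<longleftrightarrow> ?x = ?y"
    proof
      assume "inv ?x \<otimes> ?y \<in> H"
      moreover have "inv ?y \<otimes> ?y \<in> H" using c by simp
      ultimately show "?x = ?y" using R(2)[OF c(2)] idx ab by blast
    qed (use c in simp)
    have "?x = ?y \<longleftrightarrow> a div n = b div n"
      using lt xs(2) by (simp add: nth_eq_iff_index_eq t_def)
    moreover have "a = b \<longleftrightarrow> a div n = b div n \<and> a mod n = b mod n"
      by (metis div_mult_mod_eq)
    ultimately show "\<sigma> \<one> $$ (a, b) = 1\<^sub>m (t * n) $$ (a, b)"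
      using ab c mem idx by (auto simp: \<sigma>_def E_def \<rho>1)
  qed (auto simp: \<sigma>_def)
  ultimately have rep: "matrix_rep G (t * n) \<sigma>"
    by (auto simp: matrix_rep_def \<sigma>_def)
  have "character G \<sigma> = induced_char G H ?\<chi>"
  proof
    fix g
    show "character G \<sigma> g = induced_char G H ?\<chi> g"
    proof (cases "g \<in> carrier G")
      case True
      have "?\<chi> (inv h \<otimes> u \<otimes> h) = ?\<chi> u" if "h \<in> H" "u \<in> H" for h u
        using GH.character_class_function[OF \<rho>, of h u] that m_inv_consistent[OF H that(1)] by simp
      then have "induced_char G H ?\<chi> g =
          (\<Sum>x\<in>R. if inv x \<otimes> g \<otimes> x \<in> H then ?\<chi> (inv x \<otimes> g \<otimes> x) else 0)"
        by (intro induced_char_eq_transversal_sum[OF fin H R _ True]) auto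
      also have "\<dots> = (\<Sum>x\<in>R. \<Sum>m<n. E g x x m m)"
        by (intro sum.cong) (auto simp: E_def character_rep[OF \<rho>])
      also have "\<dots> = (\<Sum>l<t. \<Sum>m<n. E g (xs ! l) (xs ! l) m m)"
        by (rule sumR[symmetric])
      also have "\<dots> = (\<Sum>c<t * n. E g (xs ! (c div n)) (xs ! (c div n)) (c mod n) (c mod n))"
        by (rule sum_divmod[symmetric])
      also have "\<dots> = character G \<sigma> g"
        unfolding character_rep[OF rep True] by (intro sum.cong) (auto simp: \<sigma>_def)
      finally show ?thesis ..
    qed (simp add: character_def induced_char_def)
  qed
  then show ?thesis using that rep by blast
qed

lemma induced_char_lincomb:
  "induced_char G H (\<lambda>g. \<Sum>i\<in>I. c i * X i g) = (\<lambda>g. \<Sum>i\<in>I. c i * induced_char G H (X i) g)"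
proof
  fix g
  show "induced_char G H (\<lambda>g. \<Sum>i\<in>I. c i * X i g) g = (\<Sum>i\<in>I. c i * induced_char G H (X i) g)"
  proof (cases "g \<in> carrier G")
    case True
    then show ?thesis
      unfolding induced_char_def
      by (subst sum.swap) (simp add: sum_distrib_left sum_divide_distrib)
  qed (simp add: induced_char_def)
qed

lemma virtual_char_induced:
  assumes fin: "finite (carrier G)" and H: "subgroup H G" and X: "virtual_char (G\<lparr>carrier := H\<rparr>) X"
  shows "virtual_char G (induced_char G H X)"
proof -
  let ?GH = "G\<lparr>carrier := H\<rparr>"
  obtain R c where R: "finite R" "\<forall>\<rho>\<in>R. \<exists>n. simple_rep ?GH n \<rho>"
    "X = (\<lambda>g. \<Sum>\<rho>\<in>R. of_int (c \<rho>) * character ?GH \<rho> g)"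
    using X unfolding virtual_char_def by blast
  have "virtual_char G (induced_char G H (character ?GH \<rho>))" if "\<rho> \<in> R" for \<rho>
  proof -
    obtain n where "matrix_rep ?GH n \<rho>" using R(2) \<open>\<rho> \<in> R\<close> unfolding simple_rep_def by blast
    from induced_char_is_character[OF fin H this] show ?thesis
      by (metis virtual_char_character)
  qed
  then show ?thesis
    unfolding R(3) induced_char_lincomb by (rule virtual_char_lincomb)
qed

section \<open>The regular character and dimensions\<close>

lemma regular_char_eq:
  "regular_char G = (\<lambda>g. if g = \<one> then of_nat (card (carrier G)) else 0)"
proof
  fix g
  have "{x \<in> carrier G. g \<otimes> x = x} = (if g = \<one> then carrier G else {})" if "g \<in> carrier G"
    using that by (auto simp: r_cancel_one')
  then show "regular_char G g = (if g = \<one> then of_nat (card (carrier G)) else 0)"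
    by (auto simp: regular_char_def)
qed

text \<open>
  The regular module is induced from the trivial module of the trivial subgroup.
\<close>

lemma virtual_char_regular:
  assumes "finite (carrier G)"
  shows "virtual_char G (regular_char G)"
proof -
  let ?T = "G\<lparr>carrier := {\<one>}\<rparr>" and ?\<tau> = "\<lambda>_. 1\<^sub>m 1 :: complex mat"
  have "virtual_char ?T (character ?T ?\<tau>)"
    by (rule virtual_char_character[of _ 1]) (auto simp: matrix_rep_def)
  then have "virtual_char G (induced_char G {\<one>} (character ?T ?\<tau>))"
    by (rule virtual_char_induced[OF assms triv_subgroup])
  moreover have "induced_char G {\<one>} (character ?T ?\<tau>) = regular_char G"
  proof
    fix g
    have "{x. x \<in> carrier G \<and> inv x \<otimes> g \<otimes> x \<in> {\<one>}} = (if g = \<one> then carrier G else {})"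
      if "g \<in> carrier G"
    proof -
      have "g = \<one>" if x: "x \<in> carrier G" "inv x \<otimes> g \<otimes> x = \<one>" for x
      proof -
        have "g = x \<otimes> (inv x \<otimes> g \<otimes> x) \<otimes> inv x" using x(1) \<open>g \<in> carrier G\<close> by (simp add: m_assoc)
        then show ?thesis using x by simp
      qed
      then show ?thesis by auto
    qed
    then show "induced_char G {\<one>} (character ?T ?\<tau>) g = regular_char G g"
      by (auto simp: induced_char_def regular_char_eq character_def)
  qed
  ultimately show ?thesis by simp
qed

lemma virtual_char_one:
  assumes "virtual_char G X"
  shows "X \<one> = of_int (vdim G X)"
proof -
  obtain R c where R: "finite R" "\<forall>\<rho>\<in>R. \<exists>n. simple_rep G n \<rho>"
    "X = (\<lambda>g. \<Sum>\<rho>\<in>R. of_int (c \<rho>) * character G \<rho> g)"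
    using assms unfolding virtual_char_def by blast
  have "of_int (c \<rho>) * character G \<rho> \<one> \<in> \<int>" if "\<rho> \<in> R" for \<rho>
  proof -
    obtain n where n: "matrix_rep G n \<rho>" using R(2) \<open>\<rho> \<in> R\<close> unfolding simple_rep_def by blast
    then have "character G \<rho> \<one> = of_nat n"
      using character_rep[OF n one_closed] by (simp add: matrix_rep_def)
    then show ?thesis by simp
  qed
  then have "(\<Sum>\<rho>\<in>R. of_int (c \<rho>) * character G \<rho> \<one>) \<in> \<int>" by (rule Ints_sum)
  then obtain z where "X \<one> = of_int z" unfolding R(3) by (rule Ints_cases)
  then show ?thesis unfolding vdim_def by simp
qed

lemma induced_char_one:
  assumes "subgroup H G"
  shows "induced_char G H X \<one> = of_nat (card (carrier G)) * X \<one> / of_nat (card H)"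
proof -
  have "{x. x \<in> carrier G \<and> inv x \<otimes> \<one> \<otimes> x \<in> H} = carrier G"
    using subgroup.one_closed[OF assms] by auto
  then show ?thesis by (simp add: induced_char_def)
qed

end

section \<open>Arithmetic of the Sylow orders\<close>

lemma pairwise_coprime_prod_dvd:
  fixes D :: "'i \<Rightarrow> nat"
  assumes "finite I" "\<And>i. i \<in> I \<Longrightarrow> D i dvd y"
    and "\<And>i j. i \<in> I \<Longrightarrow> j \<in> I \<Longrightarrow> i \<noteq> j \<Longrightarrow> coprime (D i) (D j)"
  shows "(\<Prod>i\<in>I. D i) dvd y"
  using assms
proof (induction I)
  case (insert i I)
  have "coprime (D i) (\<Prod>j\<in>I. D j)"
    using insert by (intro prod_coprime_right) auto
  moreover have "(\<Prod>j\<in>I. D j) dvd y" using insert by blast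
  ultimately show ?case using insert by (simp add: divides_mult)
qed simp

text \<open>
  Each step replaces a factor \<open>q i\<close> by \<open>gcd r (q i)\<close>: if \<open>r\<close> divides \<open>q i * y\<close>, it divides
  \<open>gcd (r * y) (q i * y)\<close>.  The factor \<open>c\<close> collects what has already been replaced.
\<close>

lemma dvd_prod_gcd:
  fixes q :: "'i \<Rightarrow> nat"
  assumes "finite I" "r dvd c * (\<Prod>i\<in>I. q i)"
  shows "r dvd c * (\<Prod>i\<in>I. gcd r (q i))"
  using assms
proof (induction I arbitrary: c)
  case (insert i I)
  let ?y = "c * (\<Prod>i\<in>I. q i)"
  have "r dvd q i * ?y" using insert by (simp add: ac_simps)
  then have "r dvd gcd (r * ?y) (q i * ?y)" by simp
  also have "gcd (r * ?y) (q i * ?y) = (c * gcd r (q i)) * (\<Prod>i\<in>I. q i)"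
    by (subst gcd_mult_right) (simp add: gcd.commute)
  finally have "r dvd (c * gcd r (q i)) * (\<Prod>i\<in>I. q i)" .
  from insert.IH[OF this] show ?case using insert.hyps by (simp add: mult.assoc)
qed simp

lemma coprime_prime_power_divisors:
  assumes "prime a" "prime b" "a \<noteq> b" "x dvd a ^ k" "y dvd b ^ l"
  shows "coprime x (y :: nat)"
  using primes_coprime[OF assms(1-3)] assms(4,5) by (meson coprime_divisors coprime_power_left_iff coprime_power_right_iff)

text \<open>
  With \<open>q\<^sub>i = p\<^sub>i ^ k\<^sub>i\<close>, the \<open>i\<close>-th number is the product of all \<open>D\<^sub>j\<close> times the product \<open>F\<^sub>i\<close> of
  \<open>q\<^sub>j / D\<^sub>j\<close> over \<open>j \<noteq> i\<close>.  A prime dividing every \<open>F\<^sub>i\<close> would be one of the \<open>p\<^sub>j\<close>, but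
  \<open>F\<^sub>j\<close> is prime to \<open>p\<^sub>j\<close>.
\<close>

lemma Gcd_complementary_products:
  fixes p k D :: "'i \<Rightarrow> nat"
  assumes I: "finite I" "I \<noteq> {}" and p: "\<And>i. i \<in> I \<Longrightarrow> prime (p i)" "inj_on p I"
    and D: "\<And>i. i \<in> I \<Longrightarrow> D i dvd p i ^ k i"
  shows "Gcd ((\<lambda>i. D i * (\<Prod>j\<in>I - {i}. p j ^ k j)) ` I) = (\<Prod>i\<in>I. D i)"
proof -
  define F where "F i = (\<Prod>j\<in>I - {i}. p j ^ k j div D j)" for i
  have "D i * (\<Prod>j\<in>I - {i}. p j ^ k j) = (\<Prod>i\<in>I. D i) * F i" if "i \<in> I" for i
  proof -
    have "(\<Prod>j\<in>I - {i}. p j ^ k j) = (\<Prod>j\<in>I - {i}. D j * (p j ^ k j div D j))"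
      using D by (intro prod.cong) auto
    then show ?thesis
      using prod.remove[OF I(1) that, of D] by (simp add: F_def prod.distrib)
  qed
  then have "(\<lambda>i. D i * (\<Prod>j\<in>I - {i}. p j ^ k j)) ` I = (*) (\<Prod>i\<in>I. D i) ` F ` I"
    by (simp add: image_image)
  then have "Gcd ((\<lambda>i. D i * (\<Prod>j\<in>I - {i}. p j ^ k j)) ` I) = (\<Prod>i\<in>I. D i) * Gcd (F ` I)"
    using Gcd_mult[of "\<Prod>i\<in>I. D i" "F ` I"] by simp
  moreover have "Gcd (F ` I) = 1"
  proof (rule ccontr)
    assume "Gcd (F ` I) \<noteq> 1"
    then obtain P where P: "prime P" "P dvd Gcd (F ` I)"
      using prime_factor_nat by blast
    have *: "\<exists>j\<in>I - {i}. P = p j" if i: "i \<in> I" for i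
    proof -
      have "P dvd F i" using P i by (meson Gcd_dvd dvd_trans imageI)
      then obtain j where j: "j \<in> I - {i}" "P dvd p j ^ k j div D j"
        using P(1) I(1) unfolding F_def by (auto simp: prime_dvd_prod_iff)
      have "p j ^ k j = (p j ^ k j div D j) * D j" using j(1) D by simp
      then have "P dvd p j ^ k j" using j(2) by (metis dvd_mult2)
      then have "P = p j"
        using P(1) p(1) j(1) by (metis DiffD1 prime_dvd_power primes_dvd_imp_eq)
      then show ?thesis using j by blast
    qed
    obtain i where i: "i \<in> I" using I(2) by blast
    then obtain j where j: "j \<in> I" "P = p j" using * by blast
    then show False using *[OF j(1)] p(2) by (auto dest: inj_onD)
  qed
  ultimately show ?thesis by simp
qed

text \<open>
  The coefficients in the definition are given by \<open>LEAST\<close> and \<open>THE\<close>.  A positive coefficient of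
  \<open>r\<close> exists because any Bezout pair can be shifted, and then \<open>v\<close> is determined by \<open>q \<noteq> 0\<close>.
\<close>

lemma savitskii_bezout:
  assumes q: "0 < q"
  shows "0 < savitskii_u r q"
    and "int (savitskii_u r q) * r + savitskii_v r q * q = gcd r q"
proof -
  let ?P = "\<lambda>u. 0 < u \<and> (\<exists>v. int u * r + v * q = gcd r q)"
  obtain u v where uv: "u * r + v * q = gcd r q" using bezout_int[of r q] by blast
  \<comment> \<open>Adding a multiple of \<open>q\<close> to \<open>u\<close> is compensated in \<open>v\<close>; adding \<open>q\<close> to the remainder keeps it positive.\<close>
  define w where "w = u mod q + q"
  have "w * r + (v + (u div q - 1) * r) * q = gcd r q"
    unfolding w_def minus_div_mult_eq_mod[symmetric] using uv by (simp add: algebra_simps)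
  moreover have "0 < w" unfolding w_def using q by (simp add: add_nonneg_pos)
  ultimately have "?P (nat w)" by auto
  then have P: "?P (savitskii_u r q)" unfolding savitskii_u_def by (rule LeastI)
  then show "0 < savitskii_u r q" by blast
  obtain v' where v': "int (savitskii_u r q) * r + v' * q = gcd r q" using P by blast
  show "int (savitskii_u r q) * r + savitskii_v r q * q = gcd r q"
    unfolding savitskii_v_def using v' q by (rule_tac theI[of _ v']) (auto, metis add_left_cancel mult_cancel_right less_irrefl)
qed

lemma prod_enat: "(\<Prod>i\<in>I. enat (f i)) = enat (\<Prod>i\<in>I. f i)"
  by (induction I rule: infinite_finite_induct) (auto simp: one_enat_def)

section \<open>The Knutson Index\<close>

lemma knutson_indexD:
  assumes "knutson_index G X = enat n"
  shows "0 < n" and "\<exists>Y. regular_inverse G X n Y"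
    and "\<And>n' Y. 0 < n' \<Longrightarrow> regular_inverse G X n' Y \<Longrightarrow> n \<le> n'"
proof -
  define S where "S = {enat n | n. 0 < n \<and> (\<exists>Y. regular_inverse G X n Y)}"
  have Inf: "Inf S = enat n" using assms by (simp add: knutson_index_def S_def)
  then have "S \<noteq> {}" by (auto simp: top_enat_def)
  then have "\<exists>x. x \<in> S" by blast
  then have "(LEAST x. x \<in> S) \<in> S" by (rule LeastI_ex)
  then have "enat n \<in> S" using Inf \<open>S \<noteq> {}\<close> by (simp add: Inf_enat_def)
  then show "0 < n" "\<exists>Y. regular_inverse G X n Y"
    unfolding S_def by auto
  fix n' Y assume "0 < n'" "regular_inverse G X n' Y"
  then have "enat n' \<in> S" unfolding S_def by blast
  then have "Inf S \<le> enat n'" by (rule Inf_lower)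
  then show "n \<le> n'" using Inf by simp
qed

lemma knutson_index_eqI:
  assumes "0 < n" "regular_inverse G X n Y"
    and "\<And>n' Y. 0 < n' \<Longrightarrow> regular_inverse G X n' Y \<Longrightarrow> n \<le> n'"
  shows "knutson_index G X = enat n"
  unfolding knutson_index_def using assms by (intro antisym Inf_lower Inf_greatest) auto

text \<open>
  The integers \<open>z\<close> such that \<open>z\<close> times the regular character is a multiple of \<open>X\<close> form an ideal,
  and the Knutson Index is its positive generator: subtracting a multiple of a minimal regular inverse
  reduces \<open>z\<close> to its remainder modulo \<open>n\<close>.
\<close>

lemma knutson_index_dvd:
  assumes n: "knutson_index G X = enat n"
    and Y: "virtual_char G Y" and XY: "\<And>g. X g * Y g = of_int z * regular_char G g"
  shows "int n dvd z"
proof -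
  obtain Y0 where Y0: "virtual_char G Y0" "\<And>g. X g * Y0 g = of_nat n * regular_char G g"
    using knutson_indexD(2)[OF n] unfolding regular_inverse_def by metis
  define Y' where "Y' = (\<lambda>g. Y g + of_int (- (z div int n)) * Y0 g)"
  have "virtual_char G Y'"
    unfolding Y'_def by (intro virtual_char_add virtual_char_scale Y Y0)
  moreover have "X g * Y' g = of_nat (nat (z mod int n)) * regular_char G g" for g
  proof -
    have "X g * Y' g = of_int z * regular_char G g - of_int (z div int n) * (of_nat n * regular_char G g)"
      unfolding Y'_def XY[symmetric] Y0(2)[symmetric] by (simp add: algebra_simps)
    also have "\<dots> = of_int (z - z div int n * int n) * regular_char G g"
      by (simp add: left_diff_distrib mult.assoc)
    also have "z - z div int n * int n = int (nat (z mod int n))"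
      using knutson_indexD(1)[OF n] by (simp add: minus_div_mult_eq_mod)
    finally show ?thesis by simp
  qed
  ultimately have inv: "regular_inverse G X (nat (z mod int n)) Y'"
    unfolding regular_inverse_def by auto
  have range: "0 \<le> z mod int n" "z mod int n < int n"
    using knutson_indexD(1)[OF n] by simp_all
  have "z mod int n = 0"
  proof (rule ccontr)
    assume "z mod int n \<noteq> 0"
    then have "n \<le> nat (z mod int n)"
      using range by (intro knutson_indexD(3)[OF n _ inv]) simp
    then show False using range by linarith
  qed
  then show ?thesis by (simp add: dvd_eq_mod_eq_0)
qed

section \<open>Savitskii Restrictions\<close>

context group
begin

lemma vdim_unique: "X \<one> = of_int z \<Longrightarrow> vdim G X = z"
  unfolding vdim_def by simp

text \<open>
  Here \<open>X\<close> stands for the character of \<open>M\<close>, \<open>r\<close> for its dimension and \<open>H\<close> for a Sylow subgroup.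
  The interplay between \<open>X\<close> and its Savitskii Restriction is the same for every subgroup \<open>H\<close>;
  primes enter only when several subgroups are combined.
\<close>

context
  fixes H :: "'a set" and X :: "'a \<Rightarrow> complex" and r :: nat
  assumes fin: "finite (carrier G)" and H: "subgroup H G"
    and X1: "X \<one> = of_nat r" and r: "0 < r"
    and conj: "\<And>x g. x \<in> carrier G \<Longrightarrow> g \<in> carrier G \<Longrightarrow> X (inv x \<otimes> g \<otimes> x) = X g"
begin

interpretation H: subgroup H G by (rule H)
interpretation GH: group "G\<lparr>carrier := H\<rparr>" using H by (rule subgroup_imp_group)

lemma card_subgroup_pos: "0 < card H"
  using fin H.subset H.one_closed by (metis card_gt_0_iff empty_iff finite_subset)

text \<open>
  The regular character vanishes away from the identity, where a Savitskii Restriction is therefore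
  just a positive multiple of the original character.
\<close>

lemma savitskii_restriction_eq:
  obtains u v where "0 < u" "int u * int r + v * int (card H) = int (gcd r (card H))"
    "\<And>h. savitskii_restriction G H X h =
       (if h \<in> H then of_nat u * X h + (if h = \<one> then of_int (v * int (card H)) else 0) else 0)"
proof (rule that)
  let ?u = "savitskii_u (int r) (int (card H))" and ?v = "savitskii_v (int r) (int (card H))"
  have q: "0 < int (card H)" using card_subgroup_pos by simp
  show "0 < ?u" "int ?u * int r + ?v * int (card H) = int (gcd r (card H))"
    using savitskii_bezout[OF q, of "int r"] by simp_all
  have "vdim G X = int r" by (rule vdim_unique) (simp add: X1)
  then show "savitskii_restriction G H X h =
       (if h \<in> H then of_nat ?u * X h + (if h = \<one> then of_int (?v * int (card H)) else 0) else 0)" for h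
    using H.one_closed
    by (simp add: savitskii_restriction_def restrict_char_def GH.regular_char_eq Let_def)
qed

lemma savitskii_restriction_one: "savitskii_restriction G H X \<one> = of_nat (gcd r (card H))"
proof -
  obtain u v where uv: "int u * int r + v * int (card H) = int (gcd r (card H))"
    "\<And>h. savitskii_restriction G H X h =
       (if h \<in> H then of_nat u * X h + (if h = \<one> then of_int (v * int (card H)) else 0) else 0)"
    using savitskii_restriction_eq by metis
  have "savitskii_restriction G H X \<one> = of_int (int u * int r + v * int (card H))"
    by (simp add: uv(2) X1)
  then show ?thesis unfolding uv(1) by simp
qed

lemma regular_inverse_one:
  assumes "regular_inverse (G\<lparr>carrier := H\<rparr>) (savitskii_restriction G H X) n Y"
  shows "int (gcd r (card H)) * vdim (G\<lparr>carrier := H\<rparr>) Y = int n * int (card H)"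
    and "Y \<one> = of_int (vdim (G\<lparr>carrier := H\<rparr>) Y)"
proof -
  have Y: "virtual_char (G\<lparr>carrier := H\<rparr>) Y"
    and eq: "(\<lambda>h. savitskii_restriction G H X h * Y h) = (\<lambda>h. of_nat n * regular_char (G\<lparr>carrier := H\<rparr>) h)"
    using assms unfolding regular_inverse_def by auto
  show Y1: "Y \<one> = of_int (vdim (G\<lparr>carrier := H\<rparr>) Y)" using GH.virtual_char_one[OF Y] by simp
  have "of_int (int (gcd r (card H)) * vdim (G\<lparr>carrier := H\<rparr>) Y) = (of_int (int n * int (card H)) :: complex)"
    using fun_cong[OF eq, of \<one>] by (simp add: savitskii_restriction_one Y1 GH.regular_char_eq)
  then show "int (gcd r (card H)) * vdim (G\<lparr>carrier := H\<rparr>) Y = int n * int (card H)"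
    unfolding of_int_eq_iff .
qed

text \<open>
  Away from the identity, \<open>X\<close> and its Savitskii Restriction have the same zeros.
\<close>

lemma regular_inverse_vanishes:
  assumes "regular_inverse (G\<lparr>carrier := H\<rparr>) (savitskii_restriction G H X) n Y"
    and h: "h \<in> H" "h \<noteq> \<one>"
  shows "X h * Y h = 0"
proof -
  obtain u v where uv: "0 < u" "\<And>h. savitskii_restriction G H X h =
       (if h \<in> H then of_nat u * X h + (if h = \<one> then of_int (v * int (card H)) else 0) else 0)"
    using savitskii_restriction_eq by metis
  have "savitskii_restriction G H X h * Y h = of_nat n * regular_char (G\<lparr>carrier := H\<rparr>) h"
    using assms(1) unfolding regular_inverse_def by meson
  then show ?thesis using uv h by (simp add: GH.regular_char_eq)
qed

text \<open>
  By Frobenius' formula the induced character at \<open>g\<close> is an average of values \<open>Y u\<close> at conjugates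
  \<open>u\<close> of \<open>g\<close>.  Since \<open>X g = X u\<close>, each summand contributes \<open>X u * Y u\<close>, which is zero
  unless \<open>g\<close> is the identity.  There the index is read off from the dimensions.
\<close>

lemma induced_regular_inverse:
  assumes Y: "regular_inverse (G\<lparr>carrier := H\<rparr>) (savitskii_restriction G H X) n Y"
  shows "X g * induced_char G H Y g = of_nat (r div gcd r (card H) * n) * regular_char G g"
proof (cases "g = \<one>")
  case True
  let ?g = "gcd r (card H)" and ?D = "vdim (G\<lparr>carrier := H\<rparr>) Y"
  have g: "?g \<noteq> 0" using r by simp
  have "of_nat ?g * of_int ?D = (of_nat n * of_nat (card H) :: complex)"
    using arg_cong[OF regular_inverse_one(1)[OF Y], of of_int] by simp
  moreover have "(of_nat r :: complex) = of_nat ?g * of_nat (r div ?g)"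
    by (simp flip: of_nat_mult)
  ultimately have "of_nat r * of_int ?D = (of_nat (r div ?g * n) * of_nat (card H) :: complex)"
    by (simp add: ac_simps)
  then show ?thesis
    using True card_subgroup_pos
    by (simp add: X1 induced_char_one[OF H] regular_inverse_one(2)[OF Y] regular_char_eq field_simps)
next
  case False
  show ?thesis
  proof (cases "g \<in> carrier G")
    case True
    have "X g * Y (inv x \<otimes> g \<otimes> x) = 0" if x: "x \<in> carrier G" "inv x \<otimes> g \<otimes> x \<in> H" for x
    proof -
      have "inv x \<otimes> g \<otimes> x \<noteq> \<one>"
      proof
        assume "inv x \<otimes> g \<otimes> x = \<one>"
        moreover have "g = x \<otimes> (inv x \<otimes> g \<otimes> x) \<otimes> inv x" using x(1) True by (simp add: m_assoc)
        ultimately show False using False x by simp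
      qed
      then show ?thesis using regular_inverse_vanishes[OF Y x(2)] conj[OF x(1) True] by simp
    qed
    then have "X g * (\<Sum>x | x \<in> carrier G \<and> inv x \<otimes> g \<otimes> x \<in> H. Y (inv x \<otimes> g \<otimes> x)) = 0"
      unfolding sum_distrib_left by (intro sum.neutral) auto
    then show ?thesis using False by (auto simp: induced_char_def regular_char_eq)
  qed (use False in \<open>simp add: induced_char_def regular_char_eq\<close>)
qed

lemma vdim_induced:
  assumes Y: "regular_inverse (G\<lparr>carrier := H\<rparr>) (savitskii_restriction G H X) n Y"
    and c: "card (carrier G) = c * card H"
  shows "vdim G (induced_char G H Y) = int c * vdim (G\<lparr>carrier := H\<rparr>) Y"
  using card_subgroup_pos
  by (intro vdim_unique) (simp add: induced_char_one[OF H] regular_inverse_one(2)[OF Y] c)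

text \<open>
  The regular module is a regular inverse of every module, with index the dimension.
\<close>

lemma knutson_index_savitskii_restriction_dvd:
  assumes "knutson_index (G\<lparr>carrier := H\<rparr>) (savitskii_restriction G H X) = enat n"
  shows "n dvd gcd r (card H)"
proof -
  have "finite H" using card_subgroup_pos card_ge_0_finite by blast
  then have "virtual_char (G\<lparr>carrier := H\<rparr>) (regular_char (G\<lparr>carrier := H\<rparr>))"
    by (intro GH.virtual_char_regular) simp
  then have "int n dvd int (gcd r (card H))"
    by (rule knutson_index_dvd[OF assms])
       (auto simp: GH.regular_char_eq savitskii_restriction_one)
  then show ?thesis by simp
qed

text \<open>
  Restricted to \<open>H\<close>, the inverse \<open>Z\<close> of \<open>X\<close> becomes an inverse of the Savitskii Restriction, with
  an index \<open>t\<close> that satisfies \<open>t * card H = gcd r (card H) * dim Z\<close>.  The minimal inverse \<open>Y\<close>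
  satisfies the same relation with \<open>n\<close> in place of \<open>t\<close>, and \<open>n\<close> divides \<open>t\<close>.
\<close>

lemma vdim_local_inverse_dvd:
  assumes n: "knutson_index (G\<lparr>carrier := H\<rparr>) (savitskii_restriction G H X) = enat n"
    and Y: "regular_inverse (G\<lparr>carrier := H\<rparr>) (savitskii_restriction G H X) n Y"
    and Z: "virtual_char G Z" and XZ: "\<And>g. X g * Z g = of_int z * regular_char G g"
    and c: "card (carrier G) = c * card H"
  shows "vdim (G\<lparr>carrier := H\<rparr>) Y dvd vdim G Z"
proof -
  let ?g = "gcd r (card H)" and ?q = "card H" and ?D = "vdim (G\<lparr>carrier := H\<rparr>) Y"
  obtain u v where uv: "int u * int r + v * int ?q = int ?g"
    "\<And>h. savitskii_restriction G H X h =
       (if h \<in> H then of_nat u * X h + (if h = \<one> then of_int (v * int ?q) else 0) else 0)"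
    using savitskii_restriction_eq by metis
  note Z1 = virtual_char_one[OF Z]
  \<comment> \<open>The products of the two summands of the Savitskii Restriction with \<open>Z\<close> are
    \<open>u * z * c\<close> and \<open>v * dim Z\<close> copies of the regular module of \<open>H\<close>.\<close>
  define t where "t = int u * z * int c + v * vdim G Z"
  have "of_int (int r * vdim G Z) = (of_int (z * int c * int ?q) :: complex)"
    using XZ[of \<one>] by (simp add: X1 Z1 regular_char_eq c)
  then have rz: "int r * vdim G Z = z * int c * int ?q" unfolding of_int_eq_iff .
  have tq: "t * int ?q = int ?g * vdim G Z"
    unfolding uv(1)[symmetric] t_def using rz by (simp add: algebra_simps)
  have "savitskii_restriction G H X h * restrict_char H Z h = of_int t * regular_char (G\<lparr>carrier := H\<rparr>) h" for h
  proof (cases "h = \<one>")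
    case True
    have "savitskii_restriction G H X \<one> * Z \<one> = of_int (int ?g * vdim G Z)"
      by (simp add: savitskii_restriction_one Z1)
    also have "\<dots> = of_int t * of_nat ?q" by (simp flip: tq)
    finally show ?thesis using True by (simp add: restrict_char_def GH.regular_char_eq)
  next
    case False
    then show ?thesis using XZ[of h] by (simp add: uv(2) restrict_char_def GH.regular_char_eq regular_char_eq)
  qed
  then have "int n dvd t"
    by (rule knutson_index_dvd[OF n virtual_char_restrict[OF H Z]])
  then obtain s where "t = int n * s" by (rule dvdE)
  then have "int ?g * vdim G Z = int ?g * (?D * s)"
    using tq regular_inverse_one(1)[OF Y] by (simp add: ac_simps)
  then show ?thesis using r by simp
qed

end

end

section \<open>The Savitskii Induced Inverse\<close>

theorem theorem2p17:
  fixes G :: "('a, 'b) monoid_scheme" and m d :: nat and p k :: "nat \<Rightarrow> nat"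
    and S :: "nat \<Rightarrow> 'a set" and \<rho> :: "'a \<Rightarrow> complex mat" and M N :: "'a \<Rightarrow> complex"
  assumes "group G"
    and "finite (carrier G)"
    and "1 \<le> m"
    and "\<And>i. i \<in> {1..m} \<Longrightarrow> prime (p i)"
    and "inj_on p {1..m}"
    and "Coset.order G = (\<Prod>i=1..m. p i ^ k i)"
    and "\<And>i. i \<in> {1..m} \<Longrightarrow> subgroup (S i) G"
    and "\<And>i. i \<in> {1..m} \<Longrightarrow> card (S i) = p i ^ k i"
    and "matrix_rep G d \<rho>"
    and "0 < d"
    and "M = character G \<rho>"
    and "savitskii_induced_inverse G m S M N"
  shows "(\<exists>n. knutson_index G M = enat n \<and> regular_inverse G M n N) \<and>
         (d dvd Coset.order G \<longrightarrow>
            knutson_index G M =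
              (\<Prod>i=1..m. knutson_index (G\<lparr>carrier := S i\<rparr>) (savitskii_restriction G (S i) M)))"
proof -
  interpret group G by fact
  note fin = assms(2)
  let ?I = "{1..m}"
  let ?G = "\<lambda>i. G\<lparr>carrier := S i\<rparr>" and ?M = "\<lambda>i. savitskii_restriction G (S i) M"
  define q where "q i = p i ^ k i" for i
  have cardS: "card (S i) = q i" if "i \<in> ?I" for i using assms(8) that by (simp add: q_def)
  have cardG: "card (carrier G) = (\<Prod>i\<in>?I. q i)"
    using assms(6) by (simp add: Coset.order_def q_def)
  have G0: "0 < card (carrier G)" using fin by (auto simp: card_gt_0_iff)
  have M1: "M \<one>\<^bsub>G\<^esub> = of_nat d"
    using character_rep[OF assms(9) one_closed] assms(9,11) by (simp add: matrix_rep_def)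
  have Mconj: "M (inv\<^bsub>G\<^esub> x \<otimes>\<^bsub>G\<^esub> g \<otimes>\<^bsub>G\<^esub> x) = M g" if "x \<in> carrier G" "g \<in> carrier G" for x g
    unfolding assms(11) using assms(9) that by (rule character_class_function)
  note setting = fin assms(7) M1 assms(10) Mconj
  obtain Ns a where Ns: "\<forall>i\<in>?I. \<exists>n. knutson_index (?G i) (?M i) = enat n \<and> regular_inverse (?G i) (?M i) n (Ns i)"
    and a: "(\<Sum>i=1..m. a i * vdim G (induced_char G (S i) (Ns i)))
          = Gcd ((\<lambda>i. vdim G (induced_char G (S i) (Ns i))) ` ?I)"
    and N: "N = (\<lambda>g. \<Sum>i=1..m. of_int (a i) * induced_char G (S i) (Ns i) g)"
    using assms(12) unfolding savitskii_induced_inverse_def by blast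
  obtain K where K: "\<And>i. i \<in> ?I \<Longrightarrow> knutson_index (?G i) (?M i) = enat (K i)"
    and inv: "\<And>i. i \<in> ?I \<Longrightarrow> regular_inverse (?G i) (?M i) (K i) (Ns i)"
    using bchoice[OF Ns] by blast
  define D where "D i = nat (vdim (?G i) (Ns i))" for i
  have q0: "0 < q i" if "i \<in> ?I" for i
    using assms(4)[OF that] by (simp add: q_def prime_gt_0_nat)
  have D: "vdim (?G i) (Ns i) = int (D i)" and D0: "0 < D i"
    and gD: "gcd d (q i) * D i = K i * q i" if i: "i \<in> ?I" for i
  proof -
    have eq: "int (gcd d (q i)) * vdim (?G i) (Ns i) = int (K i * q i)"
      using regular_inverse_one(1)[OF setting inv[OF i]] i by (simp add: cardS)
    have "0 < K i * q i" using knutson_indexD(1)[OF K[OF i]] q0[OF i] by simp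
    then have "0 < int (gcd d (q i)) * vdim (?G i) (Ns i)" unfolding eq by simp
    then have pos: "0 < vdim (?G i) (Ns i)" by (simp add: zero_less_mult_iff)
    then show "0 < D i" and Di: "vdim (?G i) (Ns i) = int (D i)" by (simp_all add: D_def)
    show "gcd d (q i) * D i = K i * q i"
      using eq unfolding Di by (simp only: of_nat_mult[symmetric] of_nat_eq_iff)
  qed
  have Dq: "D i dvd q i" if i: "i \<in> ?I" for i
  proof -
    have "K i dvd gcd d (q i)"
      using knutson_index_savitskii_restriction_dvd[OF setting K[OF i]] i by (simp add: cardS)
    then obtain s where s: "gcd d (q i) = K i * s" by (rule dvdE)
    have "q i = s * D i"
      using gD[OF i] knutson_indexD(1)[OF K[OF i]] unfolding s by simp
    then show ?thesis by simp
  qed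
  have cofactor: "card (carrier G) = (\<Prod>j\<in>?I - {i}. q j) * card (S i)" if "i \<in> ?I" for i
    using prod.remove[of ?I i q] that by (simp add: cardG cardS)
  have vind: "vdim G (induced_char G (S i) (Ns i)) = int (D i * (\<Prod>j\<in>?I - {i}. q j))" if i: "i \<in> ?I" for i
    using vdim_induced[OF setting inv[OF i] cofactor[OF i]] i by (simp add: D)
  \<comment> \<open>\<open>e\<close> will be the dimension of \<open>N\<close> and the least positive dimension of a regular inverse of \<open>M\<close>.\<close>
  define e where "e = (\<Prod>i\<in>?I. D i)"
  have e0: "0 < e" unfolding e_def using D0 by (intro prod_pos) auto
  have "Gcd ((\<lambda>i. vdim G (induced_char G (S i) (Ns i))) ` ?I)
      = Gcd (int ` (\<lambda>i. D i * (\<Prod>j\<in>?I - {i}. q j)) ` ?I)"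
    unfolding image_image by (intro arg_cong[of _ _ Gcd] image_cong refl vind)
  also have "\<dots> = int e"
    unfolding Gcd_int_eq e_def q_def of_nat_eq_iff
    using assms(3,4,5) Dq unfolding q_def by (intro Gcd_complementary_products) auto
  finally have sum_e: "(\<Sum>i=1..m. a i * vdim G (induced_char G (S i) (Ns i))) = int e"
    using a by simp
  have vc: "virtual_char G (induced_char G (S i) (Ns i))" if i: "i \<in> ?I" for i
    using inv[OF i] assms(7)[OF i] by (intro virtual_char_induced[OF fin]) (auto simp: regular_inverse_def)
  have vcN: "virtual_char G N" unfolding N using vc by (rule virtual_char_lincomb)
  have N1: "N \<one>\<^bsub>G\<^esub> = of_int (int e)"
    unfolding sum_e[symmetric] N of_int_sum
    using virtual_char_one[OF vc] by (intro sum.cong) auto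
  define z where "z = (\<Sum>i=1..m. a i * int (d div gcd d (q i) * K i))"
  have MN: "M g * N g = of_int z * regular_char G g" for g
  proof -
    have "M g * N g = (\<Sum>i=1..m. of_int (a i) * (M g * induced_char G (S i) (Ns i) g))"
      unfolding N sum_distrib_left by (simp add: ac_simps)
    also have "\<dots> = (\<Sum>i=1..m. of_int (a i * int (d div gcd d (q i) * K i)) * regular_char G g)"
    proof (rule sum.cong)
      fix i assume i: "i \<in> ?I"
      have "M g * induced_char G (S i) (Ns i) g = of_nat (d div gcd d (q i) * K i) * regular_char G g"
        using induced_regular_inverse[OF setting inv[OF i]] i by (simp add: cardS)
      then show "of_int (a i) * (M g * induced_char G (S i) (Ns i) g)
          = of_int (a i * int (d div gcd d (q i) * K i)) * regular_char G g"
        by simp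
    qed simp
    finally show ?thesis by (simp only: z_def of_int_sum sum_distrib_right)
  qed
  have dim: "z' * int (card (carrier G)) = int d * vdim G Z"
    if Z: "virtual_char G Z" "\<And>g. M g * Z g = of_int z' * regular_char G g" for z' Z
  proof -
    have "of_int (z' * int (card (carrier G))) = (of_int (int d * vdim G Z) :: complex)"
      using Z(2)[of "\<one>\<^bsub>G\<^esub>"] by (simp add: M1 virtual_char_one[OF Z(1)] regular_char_eq)
    then show ?thesis unfolding of_int_eq_iff .
  qed
  have ze: "z * int (card (carrier G)) = int d * int e"
    using dim[OF vcN MN] vdim_unique[where X = N, OF N1] by simp
  have z0: "0 < z"
  proof -
    have "0 < z * int (card (carrier G))" unfolding ze using e0 assms(10) by simp
    then show ?thesis using G0 by (simp add: zero_less_mult_iff)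
  qed
  define n where "n = nat z"
  have zn: "z = int n" using z0 by (simp add: n_def)
  have ne: "n * card (carrier G) = d * e"
    using ze unfolding zn by (simp only: of_nat_mult[symmetric] of_nat_eq_iff)
  have invN: "regular_inverse G M n N"
    using vcN MN by (simp add: regular_inverse_def zn)
  have index: "knutson_index G M = enat n"
  proof (rule knutson_index_eqI[OF _ invN])
    show "0 < n" using z0 zn by simp
    fix n' Z assume n': "0 < n'" and "regular_inverse G M n' Z"
    then have Z: "virtual_char G Z" "\<And>g. M g * Z g = of_int (int n') * regular_char G g"
      unfolding regular_inverse_def by (auto dest: fun_cong)
    have Zdim: "int n' * int (card (carrier G)) = int d * vdim G Z" by (rule dim[OF Z])
    have "0 < int d * vdim G Z" unfolding Zdim[symmetric] using n' G0 by simp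
    then have Zpos: "0 < vdim G Z" by (simp add: zero_less_mult_iff)
    have "e dvd nat (vdim G Z)"
      unfolding e_def
    proof (rule pairwise_coprime_prod_dvd)
      fix i assume i: "i \<in> ?I"
      have "int (D i) dvd vdim G Z"
        using vdim_local_inverse_dvd[OF setting K[OF i] inv[OF i] Z cofactor[OF i]] i by (simp add: D)
      then show "D i dvd nat (vdim G Z)" using Zpos by (simp flip: int_dvd_int_iff)
    next
      fix i j assume ij: "i \<in> ?I" "j \<in> ?I" "i \<noteq> j"
      then have "p i \<noteq> p j" using assms(5) by (auto dest: inj_onD)
      then show "coprime (D i) (D j)"
        using ij Dq assms(4) by (intro coprime_prime_power_divisors[of "p i" "p j" _ "k i" _ "k j"]) (auto simp: q_def)
    qed simp
    then have "e \<le> nat (vdim G Z)" using Zpos by (intro dvd_imp_le) auto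
    then have "int e \<le> vdim G Z" using Zpos by simp
    then have "int d * int e \<le> int d * vdim G Z" by (intro mult_left_mono) auto
    then have "int n * int (card (carrier G)) \<le> int n' * int (card (carrier G))"
      using ze Zdim unfolding zn by simp
    then show "n \<le> n'" using G0 by simp
  qed
  have "knutson_index G M = (\<Prod>i=1..m. knutson_index (?G i) (?M i))" if d: "d dvd Coset.order G"
  proof -
    have "(\<Prod>i\<in>?I. gcd d (q i)) = d"
    proof (rule dvd_antisym)
      show "d dvd (\<Prod>i\<in>?I. gcd d (q i))"
        using dvd_prod_gcd[of ?I d 1 q] d by (simp add: Coset.order_def cardG)
      show "(\<Prod>i\<in>?I. gcd d (q i)) dvd d"
      proof (rule pairwise_coprime_prod_dvd)
        fix i j assume ij: "i \<in> ?I" "j \<in> ?I" "i \<noteq> j"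
        then have "p i \<noteq> p j" using assms(5) by (auto dest: inj_onD)
        then show "coprime (gcd d (q i)) (gcd d (q j))"
          using ij assms(4) by (intro coprime_prime_power_divisors[of "p i" "p j" _ "k i" _ "k j"]) (auto simp: q_def)
      qed auto
    qed
    then have "n * card (carrier G) = (\<Prod>i\<in>?I. gcd d (q i) * D i)"
      using ne by (simp add: e_def prod.distrib)
    also have "\<dots> = (\<Prod>i\<in>?I. K i * q i)" using gD by (intro prod.cong) auto
    also have "\<dots> = (\<Prod>i\<in>?I. K i) * card (carrier G)" by (simp add: prod.distrib cardG)
    finally have "n = (\<Prod>i\<in>?I. K i)" using G0 by simp
    then have "knutson_index G M = (\<Prod>i=1..m. enat (K i))" by (simp add: index prod_enat)
    also have "\<dots> = (\<Prod>i=1..m. knutson_index (?G i) (?M i))" using K by (intro prod.cong) auto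
    finally show ?thesis .
  qed
  then show ?thesis using index invN by blast
qed

end
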